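(* Let $G$ be a finitely generated group. Then $G$ is quasi-automatic if and only if $G$ is asynchronously automatic.
   Context: Let $A$ be a finite set of semigroup generators of a semigroup $S$ (in particular, of a group $S=G$ viewed as a semigroup), and let $p:A^+\to S$ be the canonical surjection sending a word to the element it represents. For words $u,v\in A^+$ write $u\sim v$ if $p(u)=p(v)$. The empty word is denoted $\varepsilon$. A dictionary for $S$ (over $A$) is a rational (regular) language $L\subseteq A^+$ with $p(L)=S$. For $a\in A\cup\{\varepsilon\}$ put $R_a^L=\{(u,v)\in L\times L : ua\sim v\}$. A relation $R\subseteq A^*\times A^*$ is rational if it is a rational subset of the product monoid $A^*\times A^*$, i.e. it belongs to the smallest family of subsets containing the finite subsets and closed under union, product and submonoid generation (star). The dictionary $L$ is quasi-automatic if for each $a\in A\cup\{\varepsilon\}$ the relation $R_a^L$ is rational. It is asynchronously automatic if for each $a\in A\cup\{\varepsilon\}$ the relation $R_a^L$ is recognized by a two-tape automaton, meaning a deterministic asynchronous two-tape automaton: a finite state set $Q=Q_1\sqcup Q_2$, an initial state, a set of final states, and a partial transition function $\delta:Q\times(A\cup\{\$\})\to Q$, where $\$\notin A$ is an end marker. On input $(u,v)$ the tapes contain $u\$$ and $v\$$. In a state of $Q_i$ the automaton reads the next unread symbol of tape $i$ and moves according to $\delta$. The pair $(u,v)$ is accepted if both tapes get read entirely and the state then reached is final. Otherwise (in particular if a transition is undefined or the automaton is to read from an exhausted tape before both are exhausted) it is rejected. A finitely generated group (or semigroup) is quasi-automatic (respectively asynchronously automatic) if it has a quasi-automatic (respectively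 asynchronously automatic) dictionary over some finite set of semigroup generators. *)

theory Defs
  imports "HOL-Algebra.Generated_Groups"
begin

definition free_monoid :: "'a set \<Rightarrow> 'a list monoid"
  where "free_monoid A = \<lparr>carrier = lists A, monoid.mult = (@), one = []\<rparr>"

inductive_set rational_subsets :: "('a, 'b) monoid_scheme \<Rightarrow> 'a set set"
  for M (structure)
  where
    finite: "finite X \<Longrightarrow> X \<subseteq> carrier M \<Longrightarrow> X \<in> rational_subsets M"
  | union: "X \<in> rational_subsets M \<Longrightarrow> Y \<in> rational_subsets M \<Longrightarrow> X \<union> Y \<in> rational_subsets M"
  | product: "X \<in> rational_subsets M \<Longrightarrow> Y \<in> rational_subsets M \<Longrightarrow> X <#> Y \<in> rational_subsets M"
  | star: "X \<in> rational_subsets M \<Longrightarrow> \<Inter> {N. submonoid N M \<and> X \<subseteq> N} \<in> rational_subsets M"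

definition rational_language :: "'a set \<Rightarrow> 'a list set \<Rightarrow> bool"
  where "rational_language A L \<longleftrightarrow> L \<in> rational_subsets (free_monoid A)"

definition rational_relation :: "'a set \<Rightarrow> ('a list \<times> 'a list) set \<Rightarrow> bool"
  where "rational_relation A R \<longleftrightarrow> R \<in> rational_subsets (free_monoid A \<times>\<times> free_monoid A)"

definition nonempty_words :: "'a set \<Rightarrow> 'a list set"
  where "nonempty_words A = lists A - {[]}"

text \<open>Semigroups are represented by \<^typ>\<open>('g, 'm) monoid_scheme\<close>, but the following definitions
  never refer to the unit element. Accordingly, the value of the empty word is left unspecified.\<close>

fun word_value :: "('g, 'm) monoid_scheme \<Rightarrow> 'g list \<Rightarrow> 'g"
  where
    "word_value S [a] = a"
  | "word_value S (a # b # w) = a \<otimes>\<^bsub>S\<^esub> word_value S (b # w)"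

definition semigroup_generators :: "('g, 'm) monoid_scheme \<Rightarrow> 'g set \<Rightarrow> bool"
  where "semigroup_generators S A \<longleftrightarrow>
    A \<subseteq> carrier S \<and> word_value S ` nonempty_words A = carrier S"

definition dictionary :: "('g, 'm) monoid_scheme \<Rightarrow> 'g set \<Rightarrow> 'g list set \<Rightarrow> bool"
  where "dictionary S A L \<longleftrightarrow>
    rational_language A L \<and> L \<subseteq> nonempty_words A \<and> word_value S ` L = carrier S"

text \<open>An element of \<open>A \<union> {\<epsilon>}\<close> is given as a word of length at most one.\<close>

definition letters_or_empty :: "'a set \<Rightarrow> 'a list set"
  where "letters_or_empty A = insert [] ((\<lambda>a. [a]) ` A)"

definition mult_relation ::
    "('g, 'm) monoid_scheme \<Rightarrow> 'g list set \<Rightarrow> 'g list \<Rightarrow> ('g list \<times> 'g list) set"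
  where "mult_relation S L a = {(u, v). u \<in> L \<and> v \<in> L \<and> word_value S (u @ a) = word_value S v}"

definition quasi_automatic_dictionary ::
    "('g, 'm) monoid_scheme \<Rightarrow> 'g set \<Rightarrow> 'g list set \<Rightarrow> bool"
  where "quasi_automatic_dictionary S A L \<longleftrightarrow>
    dictionary S A L \<and> (\<forall>a \<in> letters_or_empty A. rational_relation A (mult_relation S L a))"

text \<open>A tape symbol is an \<^typ>\<open>'a option\<close>: \<^term>\<open>Some a\<close> is the letter \<^term>\<open>a\<close> and
  \<^term>\<open>None\<close> is the end marker. In contrast, the outer option in the result type of
  \<open>trans\<close> expresses partiality.\<close>

record ('q, 'a) two_tape_automaton =
  states1 :: "'q set"
  states2 :: "'q set"
  initial :: 'q
  final :: "'q set"
  trans :: "'q \<Rightarrow> 'a option \<Rightarrow> 'q option"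

definition two_tape_automaton_over :: "'a set \<Rightarrow> ('q, 'a) two_tape_automaton \<Rightarrow> bool"
  where "two_tape_automaton_over A M \<longleftrightarrow>
    finite (states1 M) \<and> finite (states2 M) \<and> states1 M \<inter> states2 M = {} \<and>
    initial M \<in> states1 M \<union> states2 M \<and> final M \<subseteq> states1 M \<union> states2 M \<and>
    (\<forall>q x q'. trans M q x = Some q' \<longrightarrow>
      q \<in> states1 M \<union> states2 M \<and> x \<in> insert None (Some ` A) \<and> q' \<in> states1 M \<union> states2 M)"

text \<open>The list arguments are the unread parts of the two tapes.\<close>

inductive accepts_from ::
    "('q, 'a) two_tape_automaton \<Rightarrow> 'q \<Rightarrow> 'a option list \<Rightarrow> 'a option list \<Rightarrow> bool"
  for M
  where
    finished: "q \<in> final M \<Longrightarrow> accepts_from M q [] []"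
  | read1: "q \<in> states1 M \<Longrightarrow> trans M q x = Some q' \<Longrightarrow> accepts_from M q' xs ys \<Longrightarrow>
      accepts_from M q (x # xs) ys"
  | read2: "q \<in> states2 M \<Longrightarrow> trans M q y = Some q' \<Longrightarrow> accepts_from M q' xs ys \<Longrightarrow>
      accepts_from M q xs (y # ys)"

definition end_marked :: "'a list \<Rightarrow> 'a option list"
  where "end_marked w = map Some w @ [None]"

definition accepted_relation ::
    "'a set \<Rightarrow> ('q, 'a) two_tape_automaton \<Rightarrow> ('a list \<times> 'a list) set"
  where "accepted_relation A M =
    {(u, v). u \<in> lists A \<and> v \<in> lists A \<and>
      accepts_from M (initial M) (end_marked u) (end_marked v)}"

text \<open>Taking states from \<^typ>\<open>nat\<close> is no restriction, because the state set is finite.\<close>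

definition two_tape_recognizable :: "'a set \<Rightarrow> ('a list \<times> 'a list) set \<Rightarrow> bool"
  where "two_tape_recognizable A R \<longleftrightarrow>
    (\<exists>M :: (nat, 'a) two_tape_automaton. two_tape_automaton_over A M \<and> accepted_relation A M = R)"

definition asynchronously_automatic_dictionary ::
    "('g, 'm) monoid_scheme \<Rightarrow> 'g set \<Rightarrow> 'g list set \<Rightarrow> bool"
  where "asynchronously_automatic_dictionary S A L \<longleftrightarrow>
    dictionary S A L \<and> (\<forall>a \<in> letters_or_empty A. two_tape_recognizable A (mult_relation S L a))"

definition quasi_automatic :: "('g, 'm) monoid_scheme \<Rightarrow> bool"
  where "quasi_automatic S \<longleftrightarrow>
    (\<exists>A L. finite A \<and> semigroup_generators S A \<and> quasi_automatic_dictionary S A L)"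

definition asynchronously_automatic :: "('g, 'm) monoid_scheme \<Rightarrow> bool"
  where "asynchronously_automatic S \<longleftrightarrow>
    (\<exists>A L. finite A \<and> semigroup_generators S A \<and> asynchronously_automatic_dictionary S A L)"

end

theory Submission
  imports Defs
begin

text \<open>A deterministic two-tape automaton yields a rational relation by erasing the end markers, so
  only one direction has content, and there a new dictionary is needed.

  Let \<open>L\<close> be a quasi-automatic dictionary. If \<open>v\<close> is much longer than an equivalent word \<open>u\<close>, then an
  accepting run on \<open>(u, v)\<close> reads many consecutive letters of \<open>v\<close> without reading a letter of \<open>u\<close>, and
  a short factor with value \<open>1\<close> can be cut out of \<open>v\<close> inside \<open>L\<close>. Hence the words of \<open>L\<close> that do not
  admit such a cut form a rational dictionary \<open>L'\<close> with finitely many words for each element of the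
  group. It follows that the factors of words of \<open>L'\<close> with values in a finite set have bounded
  length.

  For \<open>u, v \<in> L'\<close> with \<open>u a \<sim> v\<close>, there is a run along which the differences \<open>inv x \<otimes> y\<close> of the
  prefixes \<open>x\<close> of \<open>u\<close> and \<open>y\<close> of \<open>v\<close> stay in a finite set \<open>F\<close>. A deterministic automaton remains
  close to this run by reading \<open>v\<close> until \<open>x\<close> matches, up to \<open>F\<close>, the prefix that \<open>y\<close> had \<open>N\<close> letters
  earlier, and only then reading \<open>u\<close>.\<close>

section \<open>Rational subsets of a monoid: elementary facts\<close>

lemma submonoid_hull_least:
  assumes "monoid M" "X \<subseteq> carrier M"
  shows "X \<subseteq> \<Inter> {N. submonoid N M \<and> X \<subseteq> N}"
    and "submonoid (\<Inter> {N. submonoid N M \<and> X \<subseteq> N}) M"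
proof -
  \<comment> \<open>The carrier is a member of the intersected family. Without any member the
    intersection would be the whole type.\<close>
  have car: "submonoid (carrier M) M"
    using assms(1) by (simp add: monoid.m_closed submonoid_def monoid.one_closed)
  show "submonoid (\<Inter> {N. submonoid N M \<and> X \<subseteq> N}) M"
    using car assms(2) by (auto simp: submonoid_def)
qed auto

lemma rational_subsets_carrier:
  assumes "monoid M" "X \<in> rational_subsets M"
  shows "X \<subseteq> carrier M"
  using assms(2)
proof induction
  case (product X Y)
  then show ?case
    using monoid.set_mult_closed[OF assms(1)] by blast
next
  case (star X)
  then show ?case
    using submonoid_hull_least(2)[OF assms(1) star.IH] by (auto dest: submonoid.subset)
qed auto

lemma rational_subsets_UN:
  assumes "finite I" "\<And>i. i \<in> I \<Longrightarrow> X i \<in> rational_subsets M"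
  shows "(\<Union>i\<in>I. X i) \<in> rational_subsets M"
  using assms
proof (induction I)
  case empty
  then show ?case using rational_subsets.finite[of "{}" M] by simp
qed (auto intro: rational_subsets.union)

lemma (in monoid) monoid_set_mult_assoc:
  assumes "H \<subseteq> carrier G" "J \<subseteq> carrier G" "K \<subseteq> carrier G"
  shows "(H <#> J) <#> K = H <#> (J <#> K)"
proof -
  have "h \<otimes> j \<otimes> k = h \<otimes> (j \<otimes> k)" if "h \<in> H" "j \<in> J" "k \<in> K" for h j k
    using that assms by (intro m_assoc) auto
  then show ?thesis unfolding set_mult_def by (auto; metis)
qed

section \<open>Factorisations of the elements of a rational subset\<close>

text \<open>Here \<open>x\<close> is the product already read and \<open>s\<close> the remainder;
  \<open>\<Phi>\<close> is required at every split visited by one factorisation of \<open>s\<close>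
  over \<open>B\<close>. Only one has to be good, because in a product of free monoids an element
  has many factorisations.\<close>

inductive factor_path ::
    "('a, 'm) monoid_scheme \<Rightarrow> 'a set \<Rightarrow> ('a \<Rightarrow> 'a \<Rightarrow> bool) \<Rightarrow> 'a \<Rightarrow> 'a \<Rightarrow> bool"
  for M (structure) and B \<Phi>
  where
    stop: "\<Phi> x \<one> \<Longrightarrow> factor_path M B \<Phi> x \<one>"
  | step: "\<Phi> x (b \<otimes> s) \<Longrightarrow> b \<in> B \<Longrightarrow> s \<in> carrier M \<Longrightarrow>
      factor_path M B \<Phi> (x \<otimes> b) s \<Longrightarrow> factor_path M B \<Phi> x (b \<otimes> s)"

definition split_in :: "('a set \<times> 'a set) set \<Rightarrow> 'a \<Rightarrow> 'a \<Rightarrow> bool"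
  where "split_in K x s \<longleftrightarrow> (\<exists>P S. (P, S) \<in> K \<and> x \<in> P \<and> s \<in> S)"

lemma split_inI: "(P, S) \<in> K \<Longrightarrow> x \<in> P \<Longrightarrow> s \<in> S \<Longrightarrow> split_in K x s"
  unfolding split_in_def by blast

lemma split_inE:
  assumes "split_in K x s"
  obtains P S where "(P, S) \<in> K" "x \<in> P" "s \<in> S"
  using assms unfolding split_in_def by blast

lemma split_in_mono: "split_in K x s \<Longrightarrow> K \<subseteq> L \<Longrightarrow> split_in L x s"
  unfolding split_in_def by blast

text \<open>A pair \<open>(P, S) \<in> K\<close> plays the role of a state of an automaton for \<open>X\<close>: \<open>P\<close> consists of labels
  of runs into the state and \<open>S\<close> of labels of runs from there to acceptance.\<close>

definition factor_system ::
    "('a, 'm) monoid_scheme \<Rightarrow> 'a set \<Rightarrow> ('a set \<times> 'a set) set \<Rightarrow> 'a set \<Rightarrow> bool"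
  where "factor_system M B K X \<longleftrightarrow> finite K \<and>
    (\<forall>P S. (P, S) \<in> K \<longrightarrow> P \<subseteq> carrier M \<and> S \<subseteq> carrier M \<and> P <#>\<^bsub>M\<^esub> S \<subseteq> X) \<and>
    (\<forall>m\<in>X. factor_path M B (split_in K) \<one>\<^bsub>M\<^esub> m)"

lemma factor_systemI:
  assumes "finite K"
    and "\<And>P S. (P, S) \<in> K \<Longrightarrow> P \<subseteq> carrier M \<and> S \<subseteq> carrier M \<and> P <#>\<^bsub>M\<^esub> S \<subseteq> X"
    and "\<And>m. m \<in> X \<Longrightarrow> factor_path M B (split_in K) \<one>\<^bsub>M\<^esub> m"
  shows "factor_system M B K X"
  unfolding factor_system_def using assms by simp

lemma factor_systemD:
  assumes "factor_system M B K X"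
  shows "finite K"
    and "(P, S) \<in> K \<Longrightarrow> P \<subseteq> carrier M \<and> S \<subseteq> carrier M \<and> P <#>\<^bsub>M\<^esub> S \<subseteq> X"
    and "m \<in> X \<Longrightarrow> factor_path M B (split_in K) \<one>\<^bsub>M\<^esub> m"
  using assms unfolding factor_system_def by auto

text \<open>Generation is stated as an induction rule by left multiplication, the direction in which
  \<open>factor_path\<close> grows.\<close>

locale generated_monoid = monoid M for M (structure) +
  fixes B
  assumes gens: "B \<subseteq> carrier M"
    and gen_induct: "m \<in> carrier M \<Longrightarrow> P \<one> \<Longrightarrow>
      (\<And>b s. b \<in> B \<Longrightarrow> s \<in> carrier M \<Longrightarrow> P s \<Longrightarrow> P (b \<otimes> s)) \<Longrightarrow> P m"
begin

lemmas generators_induct = gen_induct[consumes 1, case_names one mult]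

text \<open>Two factorisations are concatenated. Every split in the first part gets its remainder
  prolonged by \<open>n\<close>, hence the transfer condition from \<open>\<Phi>\<close> to
  \<open>\<Psi>\<close>.\<close>

lemma factor_path_append:
  assumes "factor_path M B \<Phi> x s" "x \<in> carrier M" "n \<in> carrier M"
    and "\<And>x s. x \<in> carrier M \<Longrightarrow> s \<in> carrier M \<Longrightarrow> \<Phi> x s \<Longrightarrow> \<Psi> x (s \<otimes> n)"
    and "factor_path M B \<Psi> (x \<otimes> s) n"
  shows "factor_path M B \<Psi> x (s \<otimes> n)"
  using assms(1,2,5)
proof induction
  case (stop x)
  then show ?case using assms(3) by simp
next
  case (step x b s)
  have b: "b \<in> carrier M" using step gens by auto
  have 1: "b \<otimes> s \<otimes> n = b \<otimes> (s \<otimes> n)"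
    using step b assms(3) by (simp add: m_assoc)
  have "factor_path M B \<Psi> (x \<otimes> b) (s \<otimes> n)"
    using step b by (simp add: m_assoc)
  then show ?case
    unfolding 1 using step b assms(3) assms(4)[of x "b \<otimes> s"] 1
    by (auto intro!: factor_path.step)
qed

lemma factor_path_shift:
  assumes "factor_path M B \<Phi> x s" "x \<in> carrier M" "c \<in> carrier M"
    and "\<And>x s. x \<in> carrier M \<Longrightarrow> s \<in> carrier M \<Longrightarrow> \<Phi> x s \<Longrightarrow> \<Psi> (c \<otimes> x) s"
  shows "factor_path M B \<Psi> (c \<otimes> x) s"
  using assms(1,2)
proof induction
  case (stop x)
  then show ?case using assms(4) by (auto intro!: factor_path.stop)
next
  case (step x b s)
  have b: "b \<in> carrier M" using step gens by auto
  show ?case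
    using step b assms(3,4) by (auto intro!: factor_path.step simp: m_assoc)
qed

lemma factor_path_mono:
  assumes "factor_path M B \<Phi> x s" "x \<in> carrier M"
    and "\<And>x s. x \<in> carrier M \<Longrightarrow> s \<in> carrier M \<Longrightarrow> \<Phi> x s \<Longrightarrow> \<Psi> x s"
  shows "factor_path M B \<Psi> x s"
proof -
  have "factor_path M B \<Psi> (\<one> \<otimes> x) s"
    using assms by (intro factor_path_shift[where \<Phi> = \<Phi>]) auto
  then show ?thesis using assms by simp
qed

lemma factor_system_singleton:
  assumes "m \<in> carrier M"
  shows "\<exists>K. factor_system M B K {m}"
proof -
  \<comment> \<open>The claim is generalised over the prefix \<open>x\<close>, since each induction
    step moves one generator from the remainder to the prefix.\<close>
  have "\<forall>x\<in>carrier M. \<exists>K. finite K \<and>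
      (\<forall>P S. (P, S) \<in> K \<longrightarrow> P \<subseteq> carrier M \<and> S \<subseteq> carrier M \<and> P <#> S \<subseteq> {x \<otimes> m}) \<and>
      factor_path M B (split_in K) x m"
    using assms
  proof (induction rule: generators_induct)
    case one
    show ?case
    proof
      fix x assume "x \<in> carrier M"
      then show "\<exists>K. finite K \<and>
          (\<forall>P S. (P, S) \<in> K \<longrightarrow> P \<subseteq> carrier M \<and> S \<subseteq> carrier M \<and> P <#> S \<subseteq> {x \<otimes> \<one>}) \<and>
          factor_path M B (split_in K) x \<one>"
        by (intro exI[of _ "{({x}, {\<one>})}"])
          (auto simp: set_mult_def split_in_def intro!: factor_path.stop)
    qed
  next
    case (mult b s)
    show ?case
    proof
      fix x assume x: "x \<in> carrier M"
      have b: "b \<in> carrier M" using mult.hyps gens by auto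
      obtain K where K: "finite K"
        "\<forall>P S. (P, S) \<in> K \<longrightarrow> P \<subseteq> carrier M \<and> S \<subseteq> carrier M \<and> P <#> S \<subseteq> {x \<otimes> b \<otimes> s}"
        "factor_path M B (split_in K) (x \<otimes> b) s"
        using bspec[OF mult.IH m_closed[OF x b]] by (elim exE conjE)
      let ?K = "insert ({x}, {b \<otimes> s}) K"
      have "factor_path M B (split_in ?K) (x \<otimes> b) s"
        using K(3) m_closed[OF x b]
        by (rule factor_path_mono) (erule split_in_mono, blast)
      then have path: "factor_path M B (split_in ?K) x (b \<otimes> s)"
        using mult.hyps by (intro factor_path.step) (auto 0 3 simp: split_in_def)
      have sub: "\<forall>P S. (P, S) \<in> ?K \<longrightarrow>
          P \<subseteq> carrier M \<and> S \<subseteq> carrier M \<and> P <#> S \<subseteq> {x \<otimes> (b \<otimes> s)}"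
        using K(2) x b mult.hyps m_assoc[OF x b mult.hyps(2)]
        unfolding set_mult_def by (simp add: gens)
      show "\<exists>K. finite K \<and>
          (\<forall>P S. (P, S) \<in> K \<longrightarrow> P \<subseteq> carrier M \<and> S \<subseteq> carrier M \<and> P <#> S \<subseteq> {x \<otimes> (b \<otimes> s)}) \<and>
          factor_path M B (split_in K) x (b \<otimes> s)"
        by (intro exI[of _ ?K] conjI finite.insertI[OF K(1)] sub path)
    qed
  qed
  then obtain K where "finite K"
    "\<forall>P S. (P, S) \<in> K \<longrightarrow> P \<subseteq> carrier M \<and> S \<subseteq> carrier M \<and> P <#> S \<subseteq> {m}"
    "factor_path M B (split_in K) \<one> m"
    using l_one[OF assms] by (metis one_closed)
  then show ?thesis by (metis factor_system_def singletonD)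
qed

lemma factor_system_union:
  assumes K: "factor_system M B K X" and L: "factor_system M B L Y"
  shows "factor_system M B (K \<union> L) (X \<union> Y)"
proof (rule factor_systemI)
  show "finite (K \<union> L)" using assms by (simp add: factor_systemD(1))
next
  fix P S assume "(P, S) \<in> K \<union> L"
  then show "P \<subseteq> carrier M \<and> S \<subseteq> carrier M \<and> P <#> S \<subseteq> X \<union> Y"
    using factor_systemD(2)[OF K, of P S] factor_systemD(2)[OF L, of P S] by blast
next
  fix m assume "m \<in> X \<union> Y"
  then show "factor_path M B (split_in (K \<union> L)) \<one> m"
  proof
    assume "m \<in> X"
    show ?thesis
      by (rule factor_path_mono[OF factor_systemD(3)[OF K \<open>m \<in> X\<close>] one_closed])
        (erule split_in_mono, simp)
  next
    assume "m \<in> Y"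
    show ?thesis
      by (rule factor_path_mono[OF factor_systemD(3)[OF L \<open>m \<in> Y\<close>] one_closed])
        (erule split_in_mono, simp)
  qed
qed

text \<open>A state of \<open>K\<close> may be followed by any element of \<open>Y\<close> at the
  end, and a state of \<open>L\<close> may be preceded by any element of \<open>X\<close>.
  Associativity keeps the products inside \<open>X <#> Y\<close>.\<close>

lemma factor_system_product:
  assumes "factor_system M B K X" "factor_system M B L Y" "X \<subseteq> carrier M" "Y \<subseteq> carrier M"
  shows "factor_system M B ((\<lambda>(P, S). (P, S <#> Y)) ` K \<union> (\<lambda>(P, S). (X <#> P, S)) ` L) (X <#> Y)"
    (is "factor_system M B ?N _")
proof (rule factor_systemI)
  show "finite ?N" using assms by (simp add: factor_systemD(1))
next
  fix P S assume PS: "(P, S) \<in> ?N"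
  then consider S' where "(P, S') \<in> K" "S = S' <#> Y" | P' where "(P', S) \<in> L" "P = X <#> P'"
    by auto
  then have "P \<subseteq> carrier M \<and> S \<subseteq> carrier M \<and> P <#> S \<subseteq> X <#> Y"
  proof cases
    case 1
    then have *: "P \<subseteq> carrier M" "S' \<subseteq> carrier M" "P <#> S' \<subseteq> X"
      using factor_systemD(2)[OF assms(1)] by auto
    have "P <#> S = (P <#> S') <#> Y"
      unfolding 1 using * assms(4) by (simp add: monoid_set_mult_assoc)
    then show ?thesis
      using * 1 assms(4) by (auto simp: set_mult_closed mono_set_mult)
  next
    case 2
    then have *: "P' \<subseteq> carrier M" "S \<subseteq> carrier M" "P' <#> S \<subseteq> Y"
      using factor_systemD(2)[OF assms(2)] by auto
    have "P <#> S = X <#> (P' <#> S)"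
      unfolding 2 using * assms(3) by (simp add: monoid_set_mult_assoc)
    then show ?thesis
      using * 2 assms(3) by (auto simp: set_mult_closed mono_set_mult)
  qed
  then show "P \<subseteq> carrier M \<and> S \<subseteq> carrier M \<and> P <#> S \<subseteq> X <#> Y" .
next
  fix m assume "m \<in> X <#> Y"
  then obtain x y where m: "m = x \<otimes> y" "x \<in> X" "y \<in> Y" by (auto simp: set_mult_def)
  have x: "x \<in> carrier M" "y \<in> carrier M" using m assms by auto
  have "factor_path M B (split_in ?N) (x \<otimes> \<one>) y"
  proof (rule factor_path_shift[where \<Phi> = "split_in L"])
    show "factor_path M B (split_in L) \<one> y"
      using factor_systemD(3)[OF assms(2)] m by auto
    fix z s assume "split_in L z s"
    then obtain P S where "(P, S) \<in> L" "z \<in> P" "s \<in> S" by (elim split_inE)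
    moreover have "x \<otimes> z \<in> X <#> P" using m \<open>z \<in> P\<close> by (auto simp: set_mult_def)
    ultimately show "split_in ?N (x \<otimes> z) s" by (intro split_inI[of "X <#> P" S]) auto
  qed (use x in auto)
  then have 1: "factor_path M B (split_in ?N) (\<one> \<otimes> x) y" using x by simp
  show "factor_path M B (split_in ?N) \<one> m"
    unfolding m(1)
  proof (rule factor_path_append[where \<Phi> = "split_in K", OF _ _ _ _ 1])
    show "factor_path M B (split_in K) \<one> x"
      using factor_systemD(3)[OF assms(1)] m by auto
    fix z s assume "split_in K z s"
    then obtain P S where "(P, S) \<in> K" "z \<in> P" "s \<in> S" by (elim split_inE)
    moreover have "s \<otimes> y \<in> S <#> Y" using m \<open>s \<in> S\<close> by (auto simp: set_mult_def)
    ultimately show "split_in ?N z (s \<otimes> y)" by (intro split_inI[of P "S <#> Y"]) auto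
  qed (use x in auto)
qed

text \<open>The state \<open>(Z, Z)\<close> stands for the boundary between two factors from
  \<open>X\<close>. The other states are those of \<open>K\<close> inside one factor, with arbitrary
  elements of \<open>Z\<close> before and after it.\<close>

lemma factor_system_star:
  assumes K: "factor_system M B K X" and X: "X \<subseteq> carrier M"
  defines "Z \<equiv> \<Inter> {N. submonoid N M \<and> X \<subseteq> N}"
  shows "factor_system M B (insert (Z, Z) ((\<lambda>(P, S). (Z <#> P, S <#> Z)) ` K)) Z"
    (is "factor_system M B ?N _")
proof -
  have XZ: "X \<subseteq> Z" and sub: "submonoid Z M"
    using submonoid_hull_least[OF monoid_axioms X] by (auto simp: Z_def)
  have Z: "Z \<subseteq> carrier M" "\<one> \<in> Z" "\<And>a b. a \<in> Z \<Longrightarrow> b \<in> Z \<Longrightarrow> a \<otimes> b \<in> Z"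
    using sub by (auto simp: submonoid_def)
  have PS: "P \<subseteq> carrier M \<and> S \<subseteq> carrier M \<and> P <#> S \<subseteq> Z" if N: "(P, S) \<in> ?N" for P S
  proof -
    consider "P = Z" "S = Z" | P' S' where "(P', S') \<in> K" "P = Z <#> P'" "S = S' <#> Z"
      using N by auto
    then show ?thesis
    proof cases
      case 1
      then show ?thesis using Z by (auto simp: set_mult_def)
    next
      case 2
      then have *: "P' \<subseteq> carrier M" "S' \<subseteq> carrier M" "P' <#> S' \<subseteq> X"
        using factor_systemD(2)[OF K] by auto
      have el: "z \<otimes> p \<otimes> (s \<otimes> z') \<in> Z" if "z \<in> Z" "p \<in> P'" "s \<in> S'" "z' \<in> Z" for z p s z'
      proof -
        have "z \<otimes> p \<otimes> (s \<otimes> z') = z \<otimes> ((p \<otimes> s) \<otimes> z')"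
          using that * Z by (simp add: m_assoc subset_iff)
        moreover have "p \<otimes> s \<in> Z" using * that XZ unfolding set_mult_def by blast
        ultimately show ?thesis using that Z by auto
      qed
      have "P <#> S \<subseteq> Z"
      proof
        fix n assume "n \<in> P <#> S"
        then obtain z p s z' where "n = z \<otimes> p \<otimes> (s \<otimes> z')"
          "z \<in> Z" "p \<in> P'" "s \<in> S'" "z' \<in> Z"
          unfolding 2 set_mult_def by blast
        then show "n \<in> Z" using el by simp
      qed
      then show ?thesis
        using *(1,2) 2(2,3) Z(1) by (simp add: set_mult_closed)
    qed
  qed
  \<comment> \<open>Every second component absorbs \<open>Z\<close> on the right; this is the
    transfer condition for concatenating paths.\<close>
  have right: "split_in ?N x (s \<otimes> n)" if split: "split_in ?N x s" and "n \<in> Z" "s \<in> carrier M" for x s n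
  proof -
    obtain P S where *: "(P, S) \<in> ?N" "x \<in> P" "s \<in> S"
      using split by (rule split_inE)
    have "s \<otimes> n \<in> S"
    proof (cases "S = Z")
      case True
      then show ?thesis using * that Z by auto
    next
      case False
      then obtain P' S' where "(P', S') \<in> K" "S = S' <#> Z" using * by auto
      then obtain s' z where s: "s = s' \<otimes> z" "s' \<in> S'" "z \<in> Z" "s' \<in> carrier M"
        using *(3) factor_systemD(2)[OF K, of P' S'] unfolding set_mult_def by auto
      have "s \<otimes> n = s' \<otimes> (z \<otimes> n)" using s Z that by (simp add: m_assoc subset_iff)
      then show ?thesis unfolding \<open>S = S' <#> Z\<close> using s Z that unfolding set_mult_def by blast
    qed
    then show ?thesis using *(1,2) by (intro split_inI)
  qed
  have "submonoid {m \<in> Z. \<forall>z\<in>Z. factor_path M B (split_in ?N) z m} M"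
  proof
    show "{m \<in> Z. \<forall>z\<in>Z. factor_path M B (split_in ?N) z m} \<subseteq> carrier M" using Z by auto
    show "\<one> \<in> {m \<in> Z. \<forall>z\<in>Z. factor_path M B (split_in ?N) z m}"
      using Z(2) by (auto intro!: factor_path.stop split_inI[of Z Z])
    fix x y
    assume x: "x \<in> {m \<in> Z. \<forall>z\<in>Z. factor_path M B (split_in ?N) z m}"
      and y: "y \<in> {m \<in> Z. \<forall>z\<in>Z. factor_path M B (split_in ?N) z m}"
    show "x \<otimes> y \<in> {m \<in> Z. \<forall>z\<in>Z. factor_path M B (split_in ?N) z m}"
      using x y Z right by (auto intro!: factor_path_append[where \<Phi> = "split_in ?N"])
  qed
  moreover have "X \<subseteq> {m \<in> Z. \<forall>z\<in>Z. factor_path M B (split_in ?N) z m}"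
  proof
    fix m assume m: "m \<in> X"
    have "factor_path M B (split_in ?N) z m" if z: "z \<in> Z" for z
    proof -
      have "factor_path M B (split_in K) \<one> m" using m by (rule factor_systemD(3)[OF K])
      then have "factor_path M B (split_in ?N) (z \<otimes> \<one>) m"
      proof (rule factor_path_shift)
        fix x s assume "x \<in> carrier M" "s \<in> carrier M" "split_in K x s"
        then obtain P S where "(P, S) \<in> K" "x \<in> P" "s \<in> S" by (elim split_inE)
        moreover have "z \<otimes> x \<in> Z <#> P" using z \<open>x \<in> P\<close> by (auto simp: set_mult_def)
        moreover have "s \<otimes> \<one> \<in> S <#> Z" using Z \<open>s \<in> S\<close> unfolding set_mult_def by blast
        ultimately show "split_in ?N (z \<otimes> x) s"
          using \<open>s \<in> carrier M\<close> by (intro split_inI[of "Z <#> P" "S <#> Z"]) auto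
      qed (use z Z in auto)
      then show ?thesis using z Z by (auto simp: subset_iff)
    qed
    then show "m \<in> {m \<in> Z. \<forall>z\<in>Z. factor_path M B (split_in ?N) z m}" using m XZ by auto
  qed
  ultimately have "Z \<subseteq> {m \<in> Z. \<forall>z\<in>Z. factor_path M B (split_in ?N) z m}"
    unfolding Z_def by blast
  then show ?thesis
    using PS Z(2) factor_systemD(1)[OF K] by (intro factor_systemI) auto
qed

text \<open>This is one half of Kleene's theorem, in a form without runs: a rational set has a
  finite system of states.\<close>

lemma rational_factor_system:
  assumes "X \<in> rational_subsets M"
  shows "\<exists>K. factor_system M B K X"
  using assms
proof induction
  case (finite X)
  then show ?case
  proof (induction X)
    case empty
    show ?case by (intro exI[of _ "{}"]) (auto simp: factor_system_def)
  next
    case (insert x X)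
    have "\<exists>K. factor_system M B K {x}" "\<exists>L. factor_system M B L X"
      using insert by (auto intro: factor_system_singleton)
    then obtain K L where "factor_system M B K {x}" "factor_system M B L X"
      by blast
    then have "factor_system M B (K \<union> L) ({x} \<union> X)" by (rule factor_system_union)
    then show ?case by auto
  qed
next
  case (product X Y)
  then show ?case
    using factor_system_product rational_subsets_carrier[OF monoid_axioms] by blast
next
  case (star X)
  then show ?case
    using factor_system_star rational_subsets_carrier[OF monoid_axioms] by blast
qed (blast intro: factor_system_union)

end

section \<open>Kleene's theorem for labelled graphs\<close>

inductive labelled_walk ::
    "('a, 'm) monoid_scheme \<Rightarrow> ('q \<times> 'a \<times> 'q) set \<Rightarrow> 'q \<Rightarrow> 'a \<Rightarrow> 'q \<Rightarrow> bool"
  for M (structure) and E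
  where
    nil: "labelled_walk M E p \<one> p"
  | cons: "(p, l, q) \<in> E \<Longrightarrow> labelled_walk M E q m r \<Longrightarrow> labelled_walk M E p (l \<otimes> m) r"

context monoid
begin

lemma labelled_walk_carrier:
  assumes "labelled_walk G E p m q" "E \<subseteq> UNIV \<times> carrier G \<times> UNIV"
  shows "m \<in> carrier G"
  using assms by induction auto

lemma labelled_walk_trans:
  assumes "labelled_walk G E p m q" "labelled_walk G E q n r"
    and E: "E \<subseteq> UNIV \<times> carrier G \<times> UNIV"
  shows "labelled_walk G E p (m \<otimes> n) r"
  using assms(1,2)
proof (induction)
  case (nil p)
  then show ?case using labelled_walk_carrier[OF nil E] by simp
next
  case (cons p l q m r)
  have "l \<otimes> m \<otimes> n = l \<otimes> (m \<otimes> n)"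
    using subsetD[OF E cons(1)] labelled_walk_carrier[OF cons(2) E] labelled_walk_carrier[OF cons(4) E]
    by (simp add: m_assoc)
  then show ?case using cons by (auto intro: labelled_walk.cons)
qed

lemma labelled_walk_mono:
  assumes "labelled_walk G E p m q" "E \<subseteq> E'"
  shows "labelled_walk G E' p m q"
  using assms by induction (auto intro: labelled_walk.intros)

text \<open>A walk that uses the new edge is cut at its first and last use: a walk to
  \<open>a\<close>, the edge, loops at \<open>b\<close> that each end with the edge, and a walk from
  \<open>b\<close>. The hull \<open>Z\<close> collects the labels of the loops.\<close>

lemma labelled_walks_insert:
  assumes E: "insert (a, l0, b) E \<subseteq> UNIV \<times> carrier G \<times> UNIV"
  defines "R \<equiv> \<lambda>p q. {m. labelled_walk G E p m q}"
  defines "Z \<equiv> \<Inter> {N. submonoid N G \<and> R b a <#> {l0} \<subseteq> N}"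
  shows "{m. labelled_walk G (insert (a, l0, b) E) p m q} =
    R p q \<union> ((R p a <#> {l0}) <#> (Z <#> R b q))"
    (is "?W p q = ?R p q")
proof
  have E': "E \<subseteq> UNIV \<times> carrier G \<times> UNIV" and l0: "l0 \<in> carrier G"
    using E by auto
  have R: "R p q \<subseteq> carrier G" for p q
    unfolding R_def using labelled_walk_carrier[OF _ E'] by blast
  have X: "R b a <#> {l0} \<subseteq> carrier G" using R l0 by (intro set_mult_closed) auto
  have XZ: "R b a <#> {l0} \<subseteq> Z" and sub: "submonoid Z G"
    using submonoid_hull_least[OF monoid_axioms X] by (auto simp: Z_def)
  have Z: "Z \<subseteq> carrier G" "\<one> \<in> Z" "\<And>a b. a \<in> Z \<Longrightarrow> b \<in> Z \<Longrightarrow> a \<otimes> b \<in> Z"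
    using sub by (auto simp: submonoid_def)
  have memI: "x \<otimes> l0 \<otimes> (z \<otimes> y) \<in> ?R p q" if "x \<in> R p a" "z \<in> Z" "y \<in> R b q" for x y z p q
    using that by (auto simp: set_mult_def)
  have oneR: "\<one> \<in> R p p" for p by (auto simp: R_def labelled_walk.nil)
  have "m \<in> ?R p q" if "labelled_walk G (insert (a, l0, b) E) p m q" for m p q
    using that
  proof induction
    case (nil p)
    show ?case by (rule UnI1) (rule oneR)
  next
    case (cons p l q m r)
    have mC: "m \<in> carrier G" and l: "l \<in> carrier G"
      using labelled_walk_carrier[OF cons(2) E] subsetD[OF E cons(1)] by auto
    consider "m \<in> R q r" | x z y where "m = x \<otimes> l0 \<otimes> (z \<otimes> y)" "x \<in> R q a" "z \<in> Z" "y \<in> R b r"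
      using cons by (auto simp: set_mult_def)
    then show ?case
    proof cases
      case 1
      show ?thesis
      proof (cases "(p, l, q) \<in> E")
        case True
        then have "l \<otimes> m \<in> R p r" using 1 by (auto simp: R_def intro: labelled_walk.cons)
        then show ?thesis by auto
      next
        case False
        then have *: "p = a" "l = l0" "q = b" using cons by auto
        have "\<one> \<otimes> l0 \<otimes> (\<one> \<otimes> m) \<in> ?R p r"
          using 1 * oneR Z by (intro memI) auto
        then show ?thesis using * l0 mC by simp
      qed
    next
      case 2
      have C: "x \<in> carrier G" "y \<in> carrier G" "z \<in> carrier G" using 2 R Z by auto
      show ?thesis
      proof (cases "(p, l, q) \<in> E")
        case True
        then have "l \<otimes> x \<in> R p a" using 2 by (auto simp: R_def intro: labelled_walk.cons)
        then have "l \<otimes> x \<otimes> l0 \<otimes> (z \<otimes> y) \<in> ?R p r" using 2 by (intro memI)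
        then show ?thesis using C l l0 2 by (simp add: m_assoc)
      next
        case False
        then have *: "p = a" "l = l0" "q = b" using cons by auto
        \<comment> \<open>The walk starts with the new edge and uses it again, so the part up to and
          including the next use is one more loop at \<open>b\<close>.\<close>
        have "x \<otimes> l0 \<in> Z" using XZ 2 * by (auto simp: set_mult_def)
        then have "\<one> \<otimes> l0 \<otimes> (x \<otimes> l0 \<otimes> z \<otimes> y) \<in> ?R p r"
          using 2 * oneR Z by (intro memI) auto
        then show ?thesis using * C l0 2 by (simp add: m_assoc)
      qed
    qed
  qed
  then show "?W p q \<subseteq> ?R p q" by auto
  have W: "R p q \<subseteq> ?W p q" for p q
    by (auto simp: R_def intro: labelled_walk_mono)
  have edge: "x \<otimes> l0 \<in> ?W p b" if "x \<in> R p a" for x p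
  proof -
    have "labelled_walk G (insert (a, l0, b) E) a (l0 \<otimes> \<one>) b"
      by (rule labelled_walk.cons[OF _ labelled_walk.nil]) simp
    then show ?thesis
      using that W labelled_walk_trans[OF _ _ E, of p x a "l0 \<otimes> \<one>" b] l0 by auto
  qed
  \<comment> \<open>Labels of closed walks at \<open>b\<close> form a submonoid containing the
    single loops, hence contain the hull.\<close>
  have Zw: "Z \<subseteq> {n. labelled_walk G (insert (a, l0, b) E) b n b}"
  proof -
    have "submonoid {n. labelled_walk G (insert (a, l0, b) E) b n b} G"
    proof
      show "{n. labelled_walk G (insert (a, l0, b) E) b n b} \<subseteq> carrier G"
        using labelled_walk_carrier[OF _ E] by auto
    qed (simp_all add: labelled_walk.nil labelled_walk_trans[OF _ _ E])
    moreover have "R b a <#> {l0} \<subseteq> {n. labelled_walk G (insert (a, l0, b) E) b n b}"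
      using edge by (auto simp: set_mult_def)
    ultimately show ?thesis unfolding Z_def by blast
  qed
  have el: "x \<otimes> l0 \<otimes> (z \<otimes> y) \<in> ?W p q" if "x \<in> R p a" "z \<in> Z" "y \<in> R b q" for x y z
  proof -
    let ?walk = "labelled_walk G (insert (a, l0, b) E)"
    have "?walk p (x \<otimes> l0) b" "?walk b z b" "?walk b y q"
      using edge[OF that(1)] subsetD[OF Zw that(2)] subsetD[OF W that(3)] by auto
    then show ?thesis using labelled_walk_trans[OF _ labelled_walk_trans[OF _ _ E] E] by simp
  qed
  show "?R p q \<subseteq> ?W p q"
  proof (rule Un_least[OF W], rule subsetI)
    fix m assume "m \<in> (R p a <#> {l0}) <#> (Z <#> R b q)"
    then obtain x z y where "m = x \<otimes> l0 \<otimes> (z \<otimes> y)" "x \<in> R p a" "z \<in> Z" "y \<in> R b q"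
      unfolding set_mult_def by blast
    then show "m \<in> ?W p q" using el by simp
  qed
qed

text \<open>The other half of Kleene's theorem, by induction on the edges instead of the vertices.
  The endpoints vary because the insertion formula refers to walks between other vertices.\<close>

theorem labelled_walks_rational:
  assumes "finite E" "E \<subseteq> UNIV \<times> carrier G \<times> UNIV"
  shows "{m. labelled_walk G E p m q} \<in> rational_subsets G"
  using assms
proof (induction E arbitrary: p q)
  case empty
  have "{m. labelled_walk G {} p m q} = (if p = q then {\<one>} else {})"
    by (auto elim: labelled_walk.cases intro: labelled_walk.nil)
  then show ?case by (auto intro: rational_subsets.finite)
next
  case (insert e E)
  obtain a l b where e: "e = (a, l, b)" by (cases e)
  have E: "E \<subseteq> UNIV \<times> carrier G \<times> UNIV" using insert.prems by auto
  have "{l} \<in> rational_subsets G"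
    using insert.prems e by (intro rational_subsets.finite) auto
  moreover have "{m. labelled_walk G (insert (a, l, b) E) p m q} =
      {m. labelled_walk G E p m q} \<union> (({m. labelled_walk G E p m a} <#> {l}) <#>
        (\<Inter> {N. submonoid N G \<and> {m. labelled_walk G E b m a} <#> {l} \<subseteq> N} <#>
         {m. labelled_walk G E b m q}))"
    by (rule labelled_walks_insert) (use insert.prems e in simp)
  ultimately show ?case
    by (simp add: e insert.IH[OF E] rational_subsets.intros(2-4))
qed

end

section \<open>Rational languages and relations\<close>

lemma free_monoid_simps [simp]:
  "carrier (free_monoid A) = lists A"
  "x \<otimes>\<^bsub>free_monoid A\<^esub> y = x @ y"
  "\<one>\<^bsub>free_monoid A\<^esub> = []"
  by (simp_all add: free_monoid_def)

lemma monoid_free_monoid: "monoid (free_monoid A)"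
  by (rule monoidI) auto

lemma monoid_word_pairs: "monoid (free_monoid A \<times>\<times> free_monoid A)"
  by (intro DirProd_monoid monoid_free_monoid)

lemma generated_monoid_words: "generated_monoid (free_monoid A) ((\<lambda>a. [a]) ` A)"
proof (intro generated_monoid.intro generated_monoid_axioms.intro monoid_free_monoid)
  fix m P
  assume "m \<in> carrier (free_monoid A)" "P \<one>\<^bsub>free_monoid A\<^esub>"
    "\<And>b s. b \<in> (\<lambda>a. [a]) ` A \<Longrightarrow> s \<in> carrier (free_monoid A) \<Longrightarrow> P s \<Longrightarrow>
      P (b \<otimes>\<^bsub>free_monoid A\<^esub> s)"
  then show "P m"
  proof (induction m)
    case (Cons a m)
    then show ?case using Cons.prems(3)[of "[a]" m] by auto
  qed auto
qed auto

text \<open>Each generator advances a single tape by one letter, so that factorisations of a pair of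
  words are lattice paths.\<close>

definition pair_letters :: "'a set \<Rightarrow> ('a list \<times> 'a list) set"
  where "pair_letters A = (\<lambda>a. ([a], [])) ` A \<union> (\<lambda>a. ([], [a])) ` A"

lemma generated_monoid_word_pairs:
  "generated_monoid (free_monoid A \<times>\<times> free_monoid A) (pair_letters A)" (is "generated_monoid ?M _")
proof (intro generated_monoid.intro generated_monoid_axioms.intro monoid_word_pairs)
  fix m P
  assume m: "m \<in> carrier ?M" and one: "P \<one>\<^bsub>?M\<^esub>"
    and step: "\<And>b s. b \<in> pair_letters A \<Longrightarrow> s \<in> carrier ?M \<Longrightarrow> P s \<Longrightarrow> P (b \<otimes>\<^bsub>?M\<^esub> s)"
  obtain u v where uv: "m = (u, v)" "u \<in> lists A" "v \<in> lists A" using m by auto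
  have "P ([], v)" using uv(3)
  proof (induction v)
    case Nil
    then show ?case using one by simp
  next
    case (Cons b v)
    then show ?case using step[of "([], [b])" "([], v)"] by (simp add: pair_letters_def)
  qed
  with uv(2) have "P (u, v)"
  proof (induction u)
    case (Cons a u)
    then show ?case using step[of "([a], [])" "(u, v)"] uv(3) by (simp add: pair_letters_def)
  qed
  then show "P m" by (simp add: uv)
qed (auto simp: pair_letters_def)

section \<open>Left quotients and the Myhill-Nerode description of rational languages\<close>

definition left_quotient :: "'a list set \<Rightarrow> 'a list \<Rightarrow> 'a list set"
  where "left_quotient L x = {z. x @ z \<in> L}"

lemma left_quotient_append: "left_quotient L (x @ y) = left_quotient (left_quotient L x) y"
  by (simp add: left_quotient_def)

lemma left_quotient_Nil [simp]: "left_quotient L [] = L"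
  by (simp add: left_quotient_def)

text \<open>A word has only one factorisation into letters, so the path visits every split of
  it.\<close>

lemma factor_path_all_splits:
  assumes "factor_path (free_monoid A) ((\<lambda>a. [a]) ` A) \<Phi> x s" "s = y @ z"
  shows "\<Phi> (x @ y) z"
  using assms
proof (induction arbitrary: y)
  case (step x b s)
  then obtain a where b: "b = [a]" by auto
  show ?case
  proof (cases y)
    case Nil
    then show ?thesis using step by simp
  next
    case (Cons c y')
    then show ?thesis using step b by auto
  qed
qed auto

text \<open>The left quotient by \<open>x\<close> is the union of the \<open>S\<close> over the
  states \<open>(P, S)\<close> with \<open>x\<close> in \<open>P\<close>, so it depends only on a
  subset of the finite set \<open>K\<close>.\<close>

lemma rational_finite_left_quotients:
  assumes "rational_language A L"
  shows "finite (range (left_quotient L))"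
proof -
  interpret generated_monoid "free_monoid A" "(\<lambda>a. [a]) ` A"
    by (rule generated_monoid_words)
  obtain K where K: "factor_system (free_monoid A) ((\<lambda>a. [a]) ` A) K L"
    using rational_factor_system assms unfolding rational_language_def by blast
  have "left_quotient L x = \<Union> (snd ` {k \<in> K. x \<in> fst k})" for x
  proof (intro equalityI subsetI)
    fix z assume "z \<in> left_quotient L x"
    then have "x @ z \<in> L" by (simp add: left_quotient_def)
    then have "split_in K x z"
      using factor_path_all_splits[OF factor_systemD(3)[OF K]] by fastforce
    then show "z \<in> \<Union> (snd ` {k \<in> K. x \<in> fst k})" by (elim split_inE) force
  next
    fix z assume "z \<in> \<Union> (snd ` {k \<in> K. x \<in> fst k})"
    then obtain P S where "(P, S) \<in> K" "x \<in> P" "z \<in> S" by auto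
    then have "x @ z \<in> L"
      using factor_systemD(2)[OF K, of P S] unfolding set_mult_def by simp blast
    then show "z \<in> left_quotient L x" by (simp add: left_quotient_def)
  qed
  then have "range (left_quotient L) \<subseteq> (\<lambda>J. \<Union> (snd ` J)) ` Pow K"
    by auto
  then show ?thesis using factor_systemD(1)[OF K] by (simp add: finite_subset)
qed

text \<open>The left quotients are the states of the minimal deterministic automaton, accepting when
  they contain the empty word; Kleene's theorem applies to its graph.\<close>

lemma finite_left_quotients_rational:
  assumes "finite A" "L \<subseteq> lists A" and fin: "finite (range (left_quotient L))"
  shows "rational_language A L"
proof -
  interpret monoid "free_monoid A" by (rule monoid_free_monoid)
  let ?Q = "range (left_quotient L)"
  define E where "E = (\<lambda>(D, a). (D, [a], left_quotient D [a])) ` (?Q \<times> A)"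
  have "finite E" using assms(1) fin unfolding E_def by simp
  moreover have "E \<subseteq> UNIV \<times> carrier (free_monoid A) \<times> UNIV" by (auto simp: E_def)
  ultimately have rat: "{m. labelled_walk (free_monoid A) E L m D} \<in> rational_subsets (free_monoid A)" for D
    by (rule labelled_walks_rational)
  have sound: "D' = left_quotient D m" if "labelled_walk (free_monoid A) E D m D'" for D m D'
    using that
    by induction (auto simp: E_def left_quotient_append[symmetric])
  have complete: "labelled_walk (free_monoid A) E D m (left_quotient D m)"
    if "m \<in> lists A" "D \<in> ?Q" for D m
    using that
  proof (induction m arbitrary: D)
    case Nil
    then show ?case using labelled_walk.nil[of "free_monoid A" E D] by simp
  next
    case (Cons a m)
    have "left_quotient D [a] \<in> ?Q"
      using Cons.prems by (auto simp: left_quotient_append[symmetric])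
    then have "labelled_walk (free_monoid A) E (left_quotient D [a]) m (left_quotient (left_quotient D [a]) m)"
      using Cons.IH by simp
    moreover have "(D, [a], left_quotient D [a]) \<in> E"
      unfolding E_def using Cons.hyps Cons.prems by (intro image_eqI[of _ _ "(D, a)"]) auto
    ultimately show ?case
      using labelled_walk.cons[of D "[a]" "left_quotient D [a]" E "free_monoid A" m]
      by (simp add: left_quotient_append[symmetric])
  qed
  have "L = (\<Union>D\<in>{D \<in> ?Q. [] \<in> D}. {m. labelled_walk (free_monoid A) E L m D})" (is "L = ?R")
  proof (intro equalityI subsetI)
    fix m assume "m \<in> L"
    then have "labelled_walk (free_monoid A) E L m (left_quotient L m)"
      using assms(2) by (intro complete) (auto intro: range_eqI[of _ _ "[]"])
    moreover have "[] \<in> left_quotient L m" using \<open>m \<in> L\<close> by (simp add: left_quotient_def)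
    ultimately show "m \<in> ?R" by auto
  next
    fix m assume "m \<in> ?R"
    then obtain D where "[] \<in> D" "labelled_walk (free_monoid A) E L m D" by auto
    then have "[] \<in> left_quotient L m" using sound by blast
    then show "m \<in> L" by (simp add: left_quotient_def)
  qed
  moreover have "?R \<in> rational_subsets (free_monoid A)"
    using rat fin by (intro rational_subsets_UN) auto
  ultimately show ?thesis unfolding rational_language_def by simp
qed

lemma rational_language_lists: "rational_language A L \<Longrightarrow> L \<subseteq> lists A"
  using rational_subsets_carrier[OF monoid_free_monoid] unfolding rational_language_def by fastforce

lemma rational_left_quotient:
  assumes "finite A" "rational_language A L"
  shows "rational_language A (left_quotient L x)"
proof (rule finite_left_quotients_rational[OF assms(1)])
  show "left_quotient L x \<subseteq> lists A"
    using rational_language_lists[OF assms(2)] by (auto simp: left_quotient_def)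
  have "range (left_quotient (left_quotient L x)) \<subseteq> range (left_quotient L)"
    by (auto simp: left_quotient_append[symmetric])
  then show "finite (range (left_quotient (left_quotient L x)))"
    using rational_finite_left_quotients[OF assms(2)] by (rule finite_subset)
qed

lemma rational_language_Diff:
  assumes "finite A" "rational_language A L" "rational_language A L'"
  shows "rational_language A (L - L')"
proof (rule finite_left_quotients_rational[OF assms(1)])
  show "L - L' \<subseteq> lists A"
    using rational_language_lists[OF assms(2)] by auto
  have "left_quotient (L - L') x = left_quotient L x - left_quotient L' x" for x
    by (auto simp: left_quotient_def)
  then have "range (left_quotient (L - L')) \<subseteq>
      (\<lambda>(D, D'). D - D') ` (range (left_quotient L) \<times> range (left_quotient L'))"
    by auto
  then show "finite (range (left_quotient (L - L')))"
    using rational_finite_left_quotients assms(2,3) by (meson finite_SigmaI finite_imageI finite_subset)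
qed

text \<open>These are the words leading to one state \<open>D\<close> of the minimal automaton.
  Their quotient by \<open>y\<close> is determined by the quotient of \<open>L\<close> by
  \<open>y\<close>; the extra \<open>{}\<close> accounts for \<open>y\<close> outside
  \<open>lists A\<close>.\<close>

lemma rational_same_left_quotient:
  assumes "finite A" "rational_language A L"
  shows "rational_language A {x \<in> lists A. left_quotient L x = D}"
proof (rule finite_left_quotients_rational[OF assms(1)])
  have "left_quotient {x \<in> lists A. left_quotient L x = D} y =
      (if y \<in> lists A then {z \<in> lists A. left_quotient (left_quotient L y) z = D} else {})" for y
    by (auto simp: left_quotient_def left_quotient_append)
  then have "range (left_quotient {x \<in> lists A. left_quotient L x = D}) \<subseteq>
      insert {} ((\<lambda>C. {z \<in> lists A. left_quotient C z = D}) ` range (left_quotient L))"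
    by auto
  then show "finite (range (left_quotient {x \<in> lists A. left_quotient L x = D}))"
    using rational_finite_left_quotients[OF assms(2)] by (meson finite_imageI finite_insert finite_subset)
qed auto

text \<open>Grouping the prefixes \<open>x\<close> by their left quotient \<open>D\<close> makes the
  admissible \<open>z\<close> exactly the elements of \<open>D\<close>, so the language is a finite
  union of triple products.\<close>

lemma rational_language_insertion:
  assumes "finite A" "rational_language A L" "finite Y" "Y \<subseteq> lists A"
  shows "rational_language A {x @ y @ z |x y z. y \<in> Y \<and> x @ z \<in> L}"
proof -
  let ?M = "free_monoid A"
  let ?S = "\<lambda>D. {x \<in> lists A. left_quotient L x = D}"
  have "?S D <#>\<^bsub>?M\<^esub> (Y <#>\<^bsub>?M\<^esub> D) \<in> rational_subsets ?M" if "D \<in> range (left_quotient L)" for D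
    using that assms rational_same_left_quotient[OF assms(1,2)] rational_left_quotient[OF assms(1,2)]
    unfolding rational_language_def
    by (auto intro!: rational_subsets.product rational_subsets.finite[of Y])
  then have "(\<Union>D\<in>range (left_quotient L). ?S D <#>\<^bsub>?M\<^esub> (Y <#>\<^bsub>?M\<^esub> D)) \<in> rational_subsets ?M"
    using rational_finite_left_quotients[OF assms(2)] by (intro rational_subsets_UN)
  moreover have "(\<Union>D\<in>range (left_quotient L). ?S D <#>\<^bsub>?M\<^esub> (Y <#>\<^bsub>?M\<^esub> D)) =
      {x @ y @ z |x y z. y \<in> Y \<and> x @ z \<in> L}"
    using rational_language_lists[OF assms(2)]
    by (fastforce simp: set_mult_def left_quotient_def)
  ultimately show ?thesis unfolding rational_language_def by simp
qed

section \<open>Lattice paths of a pair of words\<close>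

text \<open>In \<open>lattice_path \<Phi> x y s t\<close>, the path visits splits of the pair \<open>(x @ s, y @ t)\<close>, starting
  with the split after \<open>(x, y)\<close>.\<close>

inductive lattice_path ::
    "('a list \<Rightarrow> 'a list \<Rightarrow> 'a list \<Rightarrow> 'a list \<Rightarrow> bool) \<Rightarrow>
      'a list \<Rightarrow> 'a list \<Rightarrow> 'a list \<Rightarrow> 'a list \<Rightarrow> bool"
  for \<Phi>
  where
    stop: "\<Phi> x y [] [] \<Longrightarrow> lattice_path \<Phi> x y [] []"
  | step1: "\<Phi> x y (a # s) t \<Longrightarrow> lattice_path \<Phi> (x @ [a]) y s t \<Longrightarrow> lattice_path \<Phi> x y (a # s) t"
  | step2: "\<Phi> x y s (b # t) \<Longrightarrow> lattice_path \<Phi> x (y @ [b]) s t \<Longrightarrow> lattice_path \<Phi> x y s (b # t)"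

lemma lattice_path_start: "lattice_path \<Phi> x y s t \<Longrightarrow> \<Phi> x y s t"
  by (auto elim: lattice_path.cases)

lemma lattice_path_mono:
  assumes "lattice_path \<Phi> x y s t"
    and "\<And>x' y' s' t'. x' @ s' = x @ s \<Longrightarrow> y' @ t' = y @ t \<Longrightarrow> \<Phi> x' y' s' t' \<Longrightarrow> \<Psi> x' y' s' t'"
  shows "lattice_path \<Psi> x y s t"
  using assms by (induction) (auto intro: lattice_path.intros)

lemma factor_path_lattice_path:
  assumes "factor_path (free_monoid A \<times>\<times> free_monoid A) (pair_letters A) \<Phi> p q"
  shows "lattice_path (\<lambda>x y s t. \<Phi> (x, y) (s, t)) (fst p) (snd p) (fst q) (snd q)"
  using assms
proof induction
  case (stop p)
  then show ?case by (auto intro: lattice_path.stop)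
next
  case (step p b q)
  from \<open>b \<in> pair_letters A\<close> show ?case
    using step.hyps(1) step.IH
    by (auto simp: pair_letters_def mult_DirProd' intro!: lattice_path.step1 lattice_path.step2)
qed

text \<open>This is the form in which rationality of relations is used: two splits lying in the same
  state may exchange their remainders without leaving \<open>R\<close>.\<close>

lemma rational_relation_lattice_paths:
  assumes "rational_relation A R"
  obtains K where "finite K"
    and "\<And>P S x y s t. (P, S) \<in> K \<Longrightarrow> (x, y) \<in> P \<Longrightarrow> (s, t) \<in> S \<Longrightarrow> (x @ s, y @ t) \<in> R"
    and "\<And>u v. (u, v) \<in> R \<Longrightarrow> lattice_path (\<lambda>x y s t. split_in K (x, y) (s, t)) [] [] u v"
proof -
  let ?M = "free_monoid A \<times>\<times> free_monoid A"
  interpret generated_monoid ?M "pair_letters A" by (rule generated_monoid_word_pairs)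
  obtain K where K: "factor_system ?M (pair_letters A) K R"
    using rational_factor_system assms unfolding rational_relation_def by blast
  show thesis
  proof
    show "finite K" by (rule factor_systemD(1)[OF K])
    show "(x @ s, y @ t) \<in> R" if "(P, S) \<in> K" "(x, y) \<in> P" "(s, t) \<in> S" for P S x y s t
    proof -
      have "(x, y) \<otimes>\<^bsub>?M\<^esub> (s, t) \<in> P <#>\<^bsub>?M\<^esub> S" using that unfolding set_mult_def by blast
      then show ?thesis using factor_systemD(2)[OF K that(1)] by auto
    qed
    show "lattice_path (\<lambda>x y s t. split_in K (x, y) (s, t)) [] [] u v" if "(u, v) \<in> R" for u v
      using factor_path_lattice_path[OF factor_systemD(3)[OF K that]] by simp
  qed
qed

text \<open>A path consumes the first word letter by letter, so it cannot jump over the column of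
  \<open>x @ w\<close>.\<close>

lemma lattice_path_to_column:
  assumes "lattice_path \<Phi> x y (w @ s) t"
  shows "\<exists>z t'. t = z @ t' \<and> lattice_path \<Phi> (x @ w) (y @ z) s t'"
  using assms
proof (induction x y "w @ s" t arbitrary: w)
  case (stop x y)
  then show ?case by (auto intro: lattice_path.stop)
next
  case (step1 x y a s' t)
  show ?case
  proof (cases w)
    case Nil
    then show ?thesis
      using step1(4) lattice_path.step1[OF step1(1,2)] by (intro exI[of _ "[]"] exI[of _ t]) simp
  next
    case (Cons b w')
    then show ?thesis using step1(3)[of w'] step1(4) by auto
  qed
next
  case (step2 x y b t)
  then obtain z t' where "t = z @ t'" "lattice_path \<Phi> (x @ w) ((y @ [b]) @ z) s t'" by blast
  then show ?case by (intro exI[of _ "b # z"] exI[of _ t']) simp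
qed

lemma lattice_path_swap:
  "lattice_path \<Phi> x y s t \<Longrightarrow> lattice_path (\<lambda>y x t s. \<Phi> x y s t) y x t s"
  by (induction rule: lattice_path.induct) (auto intro: lattice_path.intros)

lemma lattice_path_leaves_column:
  assumes "lattice_path \<Phi> x y (a # s) (w @ t)"
  shows "lattice_path \<Phi> x (y @ w) (a # s) t \<or>
    (\<exists>w1 w2. w = w1 @ w2 \<and> lattice_path \<Phi> (x @ [a]) (y @ w1) s (w2 @ t))"
  using assms
proof (induction w arbitrary: y)
  case (Cons b w)
  from Cons.prems consider "lattice_path \<Phi> (x @ [a]) y s (b # w @ t)" |
    "lattice_path \<Phi> x (y @ [b]) (a # s) (w @ t)"
    by (cases rule: lattice_path.cases) auto
  then show ?case
  proof cases
    case 1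
    then show ?thesis by (intro disjI2 exI[of _ "[]"] exI[of _ "b # w"]) simp
  next
    case 2
    from Cons.IH[OF 2] show ?thesis
    proof (elim disjE exE conjE)
      fix w1 w2 assume "w = w1 @ w2" "lattice_path \<Phi> (x @ [a]) ((y @ [b]) @ w1) s (w2 @ t)"
      then show ?thesis by (intro disjI2 exI[of _ "b # w1"] exI[of _ w2]) simp
    qed auto
  qed
qed auto

lemma lattice_path_leaves_row:
  assumes "lattice_path \<Phi> x y (w @ s) (b # t)"
  shows "lattice_path \<Phi> (x @ w) y s (b # t) \<or>
    (\<exists>w1 w2. w = w1 @ w2 \<and> lattice_path \<Phi> (x @ w1) (y @ [b]) (w2 @ s) t)"
  using lattice_path_leaves_column[OF lattice_path_swap[OF assms]]
  by (auto dest: lattice_path_swap)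

lemma lattice_path_last_column:
  assumes "lattice_path \<Phi> x y [] (w @ t)"
  shows "lattice_path \<Phi> x (y @ w) [] t"
  using assms
proof (induction w arbitrary: y)
  case (Cons b w)
  then have "lattice_path \<Phi> x (y @ [b]) [] (w @ t)" by (auto elim: lattice_path.cases)
  from Cons.IH[OF this] show ?case by simp
qed simp

lemma lattice_path_last_row:
  assumes "lattice_path \<Phi> x y (w @ s) []"
  shows "lattice_path \<Phi> (x @ w) y s []"
  using lattice_path_last_column[OF lattice_path_swap[OF assms]]
  by (auto dest: lattice_path_swap)

text \<open>The path has \<open>length s + 1\<close> columns left, so by counting one of them
  contains \<open>n\<close> vertical steps. In the induction \<open>z\<close> holds the steps
  already made in the current column; a horizontal step resets it to the empty word.\<close>

lemma lattice_path_vertical_stretch: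
  assumes "lattice_path \<Phi> x (y @ z) s t" "length z \<le> n"
    and "\<And>z1 z2. z = z1 @ z2 \<Longrightarrow> \<Phi> x (y @ z1) s (z2 @ t)"
    and "n * (length s + 1) \<le> length z + length t"
  shows "\<exists>x' y' w s' t'. x' @ s' = x @ s \<and> y' @ w @ t' = y @ z @ t \<and> length w = n \<and>
    (\<forall>w1 w2. w = w1 @ w2 \<longrightarrow> \<Phi> x' (y' @ w1) s' (w2 @ t'))"
  using assms
proof (induction x "y @ z" s t arbitrary: y z)
  case (stop x)
  then show ?case by (intro exI[of _ x] exI[of _ y] exI[of _ z] exI[of _ "[]"]) simp
next
  case (step1 x a s t)
  have "\<exists>x' y' w s' t'. x' @ s' = (x @ [a]) @ s \<and> y' @ w @ t' = (y @ z) @ [] @ t \<and> length w = n \<and>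
    (\<forall>w1 w2. w = w1 @ w2 \<longrightarrow> \<Phi> x' (y' @ w1) s' (w2 @ t'))"
    using step1(4,6) lattice_path_start[OF step1(2)] by (intro step1(3)) auto
  then show ?case by simp
next
  case (step2 x s b t)
  show ?case
  proof (cases "length z = n")
    case True
    then show ?thesis
      using step2(5) by (intro exI[of _ x] exI[of _ y] exI[of _ z] exI[of _ s] exI[of _ "b # t"]) simp
  next
    case False
    have "\<exists>x' y' w s' t'. x' @ s' = x @ s \<and> y' @ w @ t' = y @ (z @ [b]) @ t \<and> length w = n \<and>
      (\<forall>w1 w2. w = w1 @ w2 \<longrightarrow> \<Phi> x' (y' @ w1) s' (w2 @ t'))"
    proof (rule step2(3))
      fix z1 z2 assume z: "z @ [b] = z1 @ z2"
      show "\<Phi> x (y @ z1) s (z2 @ t)"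
      proof (cases z2 rule: rev_cases)
        case Nil
        then show ?thesis using lattice_path_start[OF step2(2)] z by simp
      next
        case (snoc z2' c)
        then show ?thesis using step2(5)[of z1 z2'] z by simp
      qed
    qed (use step2 False in auto)
    then show ?thesis by simp
  qed
qed

text \<open>Only a bounded factor of the longer word is cut out, which is what makes the words that
  cannot be shortened a rational language.\<close>

lemma rational_relation_pumping:
  assumes "rational_relation A R"
  shows "\<exists>n. \<forall>u v. (u, v) \<in> R \<longrightarrow> n * (length u + 1) \<le> length v \<longrightarrow>
    (\<exists>v1 y v2. v = v1 @ y @ v2 \<and> y \<noteq> [] \<and> length y \<le> n \<and> (u, v1 @ v2) \<in> R)"
proof -
  obtain K where K: "finite K"
    "\<And>P S x y s t. (P, S) \<in> K \<Longrightarrow> (x, y) \<in> P \<Longrightarrow> (s, t) \<in> S \<Longrightarrow> (x @ s, y @ t) \<in> R"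
    "\<And>u v. (u, v) \<in> R \<Longrightarrow> lattice_path (\<lambda>x y s t. split_in K (x, y) (s, t)) [] [] u v"
    using rational_relation_lattice_paths[OF assms] by metis
  show ?thesis
  proof (intro exI[of _ "card K"] allI impI)
    fix u v assume uv: "(u, v) \<in> R" "card K * (length u + 1) \<le> length v"
    have start: "lattice_path (\<lambda>x y s t. split_in K (x, y) (s, t)) [] ([] @ []) u v"
      using K(3)[OF uv(1)] by simp
    obtain x y w s t where w: "x @ s = u" "y @ w @ t = v" "length w = card K"
      "\<And>w1 w2. w = w1 @ w2 \<Longrightarrow> split_in K (x, y @ w1) (s, w2 @ t)"
      using lattice_path_vertical_stretch[OF start, of "card K"] lattice_path_start[OF start] uv(2)
      by auto
    have "\<forall>i. \<exists>k\<in>K. (x, y @ take i w) \<in> fst k \<and> (s, drop i w @ t) \<in> snd k"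
      using w(4)[of "take _ w" "drop _ w"] unfolding split_in_def by force
    then obtain k where k: "\<And>i. k i \<in> K" "\<And>i. (x, y @ take i w) \<in> fst (k i)"
      "\<And>i. (s, drop i w @ t) \<in> snd (k i)"
      by metis
    \<comment> \<open>The stretch has \<open>card K\<close> letters and therefore
      \<open>card K + 1\<close> splits.\<close>
    have "\<not> inj_on k {..card K}"
      using card_inj_on_le[of k "{..card K}" K] K(1) k(1) by auto
    then obtain i j where ij: "i < j" "j \<le> card K" "k i = k j"
      by (metis atMost_iff inj_onI linorder_neqE_nat)
    \<comment> \<open>The prefix at split \<open>i\<close> is joined to the remainder at split
      \<open>j\<close>. The first word is unchanged, as both splits lie in the same column.\<close>
    have "(x @ s, (y @ take i w) @ (drop j w @ t)) \<in> R"
      using K(2)[of "fst (k i)" "snd (k i)"] k ij(3) by (metis prod.collapse)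
    moreover have "v = (y @ take i w) @ drop i (take j w) @ (drop j w @ t)"
      using w(2) ij(1) by (metis append.assoc append_take_drop_id less_imp_le_nat min.absorb1 take_take)
    moreover have "drop i (take j w) \<noteq> []" "length (drop i (take j w)) \<le> card K"
      using ij w(3) by auto
    ultimately show "\<exists>v1 y v2. v = v1 @ y @ v2 \<and> y \<noteq> [] \<and> length y \<le> card K \<and> (u, v1 @ v2) \<in> R"
      using w(1) by blast
  qed
qed

section \<open>Deterministic two-tape automata\<close>

text \<open>The unread part of a tape with unread word \<open>w\<close>; \<open>f\<close> tells whether the end marker has been
  read.\<close>

definition unread :: "bool \<Rightarrow> 'a list \<Rightarrow> 'a option list"
  where "unread f w = (if f then [] else end_marked w)"

lemma end_marked_simps [simp]: "end_marked [] = [None]" "end_marked (a # w) = Some a # end_marked w"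
  by (simp_all add: end_marked_def)

lemma unread_simps [simp]:
  "unread True w = []" "unread False [] = [None]" "unread False (a # w) = Some a # unread False w"
  by (simp_all add: unread_def)

lemma unread_Cons_cases:
  assumes "x # xs = unread f w"
  obtains "\<not> f" "w = []" "x = None" "xs = unread True []"
  | a w' where "\<not> f" "w = a # w'" "x = Some a" "xs = unread False w'"
  using assms by (cases f; cases w) auto

lemma unread_Nil_iff: "unread f w = [] \<longleftrightarrow> f"
  by (cases w) (auto simp: unread_def)

text \<open>Once the end markers are erased from the labels, the flags have to prevent a walk from
  reading a tape beyond its marker.\<close>

inductive_set erased_transitions ::
    "'a set \<Rightarrow> ('q, 'a) two_tape_automaton \<Rightarrow>
      (('q \<times> bool \<times> bool) \<times> ('a list \<times> 'a list) \<times> ('q \<times> bool \<times> bool)) set"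
  for A M
  where
    letter1: "q \<in> states1 M \<Longrightarrow> a \<in> A \<Longrightarrow> trans M q (Some a) = Some q' \<Longrightarrow>
      ((q, False, g), ([a], []), (q', False, g)) \<in> erased_transitions A M"
  | end1: "q \<in> states1 M \<Longrightarrow> trans M q None = Some q' \<Longrightarrow>
      ((q, False, g), ([], []), (q', True, g)) \<in> erased_transitions A M"
  | letter2: "q \<in> states2 M \<Longrightarrow> a \<in> A \<Longrightarrow> trans M q (Some a) = Some q' \<Longrightarrow>
      ((q, f, False), ([], [a]), (q', f, False)) \<in> erased_transitions A M"
  | end2: "q \<in> states2 M \<Longrightarrow> trans M q None = Some q' \<Longrightarrow>
      ((q, f, False), ([], []), (q', f, True)) \<in> erased_transitions A M"

lemma erased_walk_sound:
  assumes "labelled_walk (free_monoid A \<times>\<times> free_monoid A) (erased_transitions A M)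
      (q, f, g) (u, v) (q', True, True)"
    and "q' \<in> final M"
  shows "(f \<longrightarrow> u = []) \<and> (g \<longrightarrow> v = []) \<and> accepts_from M q (unread f u) (unread g v)"
  using assms
proof (induction "(q, f, g)" "(u, v)" "(q', True, True)" arbitrary: q f g u v
    rule: labelled_walk.induct)
  case nil
  then show ?case by (auto intro: accepts_from.finished)
next
  case (cons l p m)
  obtain q1 f1 g1 where p: "p = (q1, f1, g1)" by (cases p) auto
  obtain u1 v1 where m: "m = (u1, v1)" by (cases m) auto
  obtain l1 l2 where l: "l = (l1, l2)" by (cases l) auto
  have IH: "(f1 \<longrightarrow> u1 = []) \<and> (g1 \<longrightarrow> v1 = []) \<and> accepts_from M q1 (unread f1 u1) (unread g1 v1)"
    using cons p m by simp
  have uv: "u = fst l @ u1" "v = snd l @ v1" using cons.hyps m by (simp_all add: mult_DirProd')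
  from \<open>((q, f, g), l, p) \<in> erased_transitions A M\<close> show ?case
    unfolding uv p l
    by (cases rule: erased_transitions.cases)
      (use IH in \<open>auto intro: accepts_from.read1 accepts_from.read2\<close>)
qed

lemma erased_walk_complete:
  assumes "accepts_from M q xs ys"
    and "xs = unread f u" "ys = unread g v" "u \<in> lists A" "v \<in> lists A"
    and "f \<Longrightarrow> u = []" "g \<Longrightarrow> v = []"
  shows "\<exists>q'\<in>final M. labelled_walk (free_monoid A \<times>\<times> free_monoid A) (erased_transitions A M)
      (q, f, g) (u, v) (q', True, True)"
  using assms
proof (induction arbitrary: f g u v)
  case (finished q)
  then have "f" "g" using unread_Nil_iff by metis+
  then show ?case
    using labelled_walk.nil[of "free_monoid A \<times>\<times> free_monoid A" "erased_transitions A M" "(q, True, True)"]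
      finished by (auto intro!: bexI[of _ q])
next
  case (read1 q x q1 xs ys)
  from read1.prems(1) show ?case
  proof (cases rule: unread_Cons_cases)
    case 1
    have "\<exists>q'\<in>final M. labelled_walk (free_monoid A \<times>\<times> free_monoid A) (erased_transitions A M)
      (q1, True, g) (u, v) (q', True, True)"
      using read1.prems 1 by (intro read1.IH) auto
    then show ?thesis
      using labelled_walk.cons[OF erased_transitions.end1] read1.hyps 1 by fastforce
  next
    case (2 a u')
    have "\<exists>q'\<in>final M. labelled_walk (free_monoid A \<times>\<times> free_monoid A) (erased_transitions A M)
      (q1, False, g) (u', v) (q', True, True)"
      using read1.prems 2 by (intro read1.IH) auto
    then show ?thesis
      using labelled_walk.cons[OF erased_transitions.letter1] read1.hyps read1.prems(3) 2 by fastforce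
  qed
next
  case (read2 q y q1 xs ys)
  from read2.prems(2) show ?case
  proof (cases rule: unread_Cons_cases)
    case 1
    have "\<exists>q'\<in>final M. labelled_walk (free_monoid A \<times>\<times> free_monoid A) (erased_transitions A M)
      (q1, f, True) (u, v) (q', True, True)"
      using read2.prems 1 by (intro read2.IH) auto
    then show ?thesis
      using labelled_walk.cons[OF erased_transitions.end2] read2.hyps 1 by fastforce
  next
    case (2 a v')
    have "\<exists>q'\<in>final M. labelled_walk (free_monoid A \<times>\<times> free_monoid A) (erased_transitions A M)
      (q1, f, False) (u, v') (q', True, True)"
      using read2.prems 2 by (intro read2.IH) auto
    then show ?thesis
      using labelled_walk.cons[OF erased_transitions.letter2] read2.hyps read2.prems(4) 2 by fastforce
  qed
qed

lemma accepted_relation_rational: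
  assumes "finite A" and M: "two_tape_automaton_over A M"
  shows "rational_relation A (accepted_relation A M)"
proof -
  let ?P = "free_monoid A \<times>\<times> free_monoid A" and ?E = "erased_transitions A M"
  interpret monoid ?P by (rule monoid_word_pairs)
  let ?Q = "states1 M \<union> states2 M"
  let ?S = "?Q \<times> (UNIV :: bool set) \<times> (UNIV :: bool set)"
  have Q: "finite ?Q" "final M \<subseteq> ?Q" "\<And>q x q'. trans M q x = Some q' \<Longrightarrow> q' \<in> ?Q"
    using M unfolding two_tape_automaton_over_def by auto
  have E: "?E \<subseteq> UNIV \<times> carrier ?P \<times> UNIV"
    by (auto elim!: erased_transitions.cases)
  have "?E \<subseteq> ?S \<times> insert ([], []) (pair_letters A) \<times> ?S"
    by (auto elim!: erased_transitions.cases dest: Q(3) simp: pair_letters_def)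
  moreover have "finite (pair_letters A)" using assms(1) by (simp add: pair_letters_def)
  ultimately have "finite ?E" using Q(1) by (meson finite_SigmaI finite_insert finite_subset finite_UNIV)
  then have rat: "{m. labelled_walk ?P ?E p m q} \<in> rational_subsets ?P" for p q
    using E by (rule labelled_walks_rational)
  have "accepted_relation A M =
      (\<Union>q'\<in>final M. {m. labelled_walk ?P ?E (initial M, False, False) m (q', True, True)})"
    (is "_ = ?R")
  proof (intro equalityI subsetI)
    fix m assume "m \<in> accepted_relation A M"
    then obtain u v where "m = (u, v)" "u \<in> lists A" "v \<in> lists A"
      "accepts_from M (initial M) (unread False u) (unread False v)"
      by (auto simp: accepted_relation_def unread_def)
    then show "m \<in> ?R"
      using erased_walk_complete[of M "initial M" _ _ False u False v A] by simp
  next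
    fix m assume "m \<in> ?R"
    then obtain q' where q': "q' \<in> final M"
      "labelled_walk ?P ?E (initial M, False, False) m (q', True, True)" by auto
    obtain u v where m: "m = (u, v)" by (cases m)
    have "m \<in> carrier ?P" using labelled_walk_carrier[OF q'(2) E] .
    moreover have "accepts_from M (initial M) (unread False u) (unread False v)"
      using erased_walk_sound[OF q'(2)[unfolded m] q'(1)] by simp
    ultimately show "m \<in> accepted_relation A M"
      using m by (auto simp: accepted_relation_def unread_def)
  qed
  moreover have "?R \<in> rational_subsets ?P"
    using rat finite_subset[OF Q(2,1)] by (intro rational_subsets_UN) auto
  ultimately show ?thesis unfolding rational_relation_def by simp
qed

text \<open>The generators and the dictionary are kept; only the description of the relations
  changes.\<close>

lemma asynchronously_automatic_imp_quasi_automatic: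
  assumes "asynchronously_automatic S"
  shows "quasi_automatic S"
  using assms accepted_relation_rational
  unfolding asynchronously_automatic_def quasi_automatic_def
    asynchronously_automatic_dictionary_def quasi_automatic_dictionary_def two_tape_recognizable_def
  by metis

text \<open>Numbering the states allows automata with structured states, such as tuples, to be used
  below.\<close>

lemma two_tape_recognizableI:
  fixes M :: "('q, 'a) two_tape_automaton"
  assumes M: "two_tape_automaton_over A M"
  shows "two_tape_recognizable A (accepted_relation A M)"
proof -
  let ?Q = "states1 M \<union> states2 M"
  have Q: "finite ?Q" "initial M \<in> ?Q" "final M \<subseteq> ?Q" "states1 M \<inter> states2 M = {}"
    "\<And>q x q'. trans M q x = Some q' \<Longrightarrow> q \<in> ?Q \<and> x \<in> insert None (Some ` A) \<and> q' \<in> ?Q"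
    using M unfolding two_tape_automaton_over_def by auto
  obtain f :: "'q \<Rightarrow> nat" where f: "inj_on f ?Q"
    using finite_imp_inj_to_nat_seg[OF Q(1)] by auto
  define N :: "(nat, 'a) two_tape_automaton" where
    "N = \<lparr>states1 = f ` states1 M, states2 = f ` states2 M, initial = f (initial M),
      final = f ` final M,
      trans = (\<lambda>n x. if n \<in> f ` ?Q then map_option f (trans M (inv_into ?Q f n) x) else None)\<rparr>"
  have inv: "inv_into ?Q f (f q) = q" if "q \<in> ?Q" for q
    using f that by (rule inv_into_f_f)
  have trans: "trans N (f q) x = map_option f (trans M q x)" if "q \<in> ?Q" for q x
    using that inv by (auto simp: N_def)
  have st: "f q \<in> states1 N \<longleftrightarrow> q \<in> states1 M" "f q \<in> states2 N \<longleftrightarrow> q \<in> states2 M"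
    "f q \<in> final N \<longleftrightarrow> q \<in> final M" if "q \<in> ?Q" for q
    using that f Q(3) by (auto simp: N_def inj_on_def)
  have 1: "accepts_from N (f q) xs ys" if "accepts_from M q xs ys" "q \<in> ?Q" for q xs ys
    using that
  proof induction
    case (finished q)
    then show ?case using st by (auto intro: accepts_from.finished)
  next
    case (read1 q x q' xs ys)
    then show ?case using st(1)[of q] trans[of q x] Q(5)[of q x q']
      by (auto intro: accepts_from.read1)
  next
    case (read2 q x q' xs ys)
    then show ?case using st(2)[of q] trans[of q x] Q(5)[of q x q']
      by (auto intro: accepts_from.read2)
  qed
  have 2: "accepts_from M q xs ys" if "accepts_from N n xs ys" "n = f q" "q \<in> ?Q" for n q xs ys
    using that
  proof (induction arbitrary: q)
    case (finished n)
    then show ?case using st by (auto intro: accepts_from.finished)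
  next
    case (read1 n x n' xs ys)
    then obtain q' where "trans M q x = Some q'" "n' = f q'"
      using trans[of q x] by (cases "trans M q x") auto
    then show ?case using read1 st(1)[of q] Q(5)[of q x q'] by (auto intro: accepts_from.read1)
  next
    case (read2 n x n' xs ys)
    then obtain q' where "trans M q x = Some q'" "n' = f q'"
      using trans[of q x] by (cases "trans M q x") auto
    then show ?case using read2 st(2)[of q] Q(5)[of q x q'] by (auto intro: accepts_from.read2)
  qed
  have "initial N = f (initial M)" by (simp add: N_def)
  then have "accepted_relation A N = accepted_relation A M"
    using 1 2 Q(2) unfolding accepted_relation_def by auto
  moreover have "two_tape_automaton_over A N"
  proof -
    have "f ` states1 M \<inter> f ` states2 M = {}"
      using inj_on_image_Int[OF f, of "states1 M" "states2 M"] Q(4) by simp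
    moreover have "n \<in> f ` ?Q \<and> x \<in> insert None (Some ` A) \<and> n' \<in> f ` ?Q"
      if "trans N n x = Some n'" for n x n'
    proof -
      obtain q where q: "q \<in> ?Q" "n = f q" using \<open>trans N n x = Some n'\<close>
        by (auto simp: N_def split: if_splits)
      then obtain q' where "trans M q x = Some q'" "n' = f q'"
        using \<open>trans N n x = Some n'\<close> trans[of q x] by (cases "trans M q x") auto
      then show ?thesis using Q(5)[of q x q'] q by blast
    qed
    moreover have "finite (states1 N)" "finite (states2 N)" "states1 N = f ` states1 M"
      "states2 N = f ` states2 M" "states1 N \<union> states2 N = f ` ?Q"
      "initial N \<in> f ` ?Q" "final N \<subseteq> f ` ?Q"
      using Q(1-3) by (simp_all add: N_def image_Un[symmetric] image_mono)
    ultimately show ?thesis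
      unfolding two_tape_automaton_over_def by metis
  qed
  ultimately show ?thesis unfolding two_tape_recognizable_def by blast
qed

section \<open>Passing close to a lattice path\<close>

text \<open>The position \<open>(x, y)\<close> need not lie on the path. In the first case it is at
  most \<open>N\<close> letters ahead of a point of the path on the first tape, in the second case
  on the second tape.\<close>

definition near_path ::
    "('a list \<Rightarrow> 'a list \<Rightarrow> 'a list \<Rightarrow> 'a list \<Rightarrow> bool) \<Rightarrow> nat \<Rightarrow>
      'a list \<Rightarrow> 'a list \<Rightarrow> 'a list \<Rightarrow> 'a list \<Rightarrow> bool"
  where "near_path \<Phi> N x y s t \<longleftrightarrow>
    (\<exists>x' w. x = x' @ w \<and> length w \<le> N \<and> lattice_path \<Phi> x' y (w @ s) t) \<or>
    (\<exists>y' w. y = y' @ w \<and> length w \<le> N \<and> lattice_path \<Phi> x y' s (w @ t))"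

lemma near_pathI1:
  "lattice_path \<Phi> x' y (w @ s) t \<Longrightarrow> length w \<le> N \<Longrightarrow> x = x' @ w \<Longrightarrow> near_path \<Phi> N x y s t"
  unfolding near_path_def by blast

lemma near_pathI2:
  "lattice_path \<Phi> x y' s (w @ t) \<Longrightarrow> length w \<le> N \<Longrightarrow> y = y' @ w \<Longrightarrow> near_path \<Phi> N x y s t"
  unfolding near_path_def by blast

lemma near_pathE:
  assumes "near_path \<Phi> N x y s t"
  obtains x' w where "x = x' @ w" "length w \<le> N" "lattice_path \<Phi> x' y (w @ s) t"
  | y' w where "y = y' @ w" "length w \<le> N" "lattice_path \<Phi> x y' s (w @ t)"
  using assms unfolding near_path_def by blast

text \<open>If the position is ahead on the second tape, following the path out of its column does
  not increase the distance. If it is ahead on the first tape, the last hypothesis gives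
  \<open>t = []\<close>, and then the path has to run along the row through the position
  itself.\<close>

lemma near_path_read1:
  assumes "near_path \<Phi> N x y (a # s) t" "0 < N"
    and "\<And>x' w. x = x' @ w \<Longrightarrow> lattice_path \<Phi> x' y (w @ a # s) t \<Longrightarrow> t = []"
  shows "near_path \<Phi> N (x @ [a]) y s t"
  using assms(1)
proof (rule near_pathE)
  fix x' w assume w: "x = x' @ w" "length w \<le> N" "lattice_path \<Phi> x' y (w @ a # s) t"
  have "t = []" using assms(3) w(1,3) .
  then have "lattice_path \<Phi> x y (a # s) t" using w lattice_path_last_row by blast
  then show ?thesis
    using assms(2) by (intro near_pathI1[of _ x _ "[a]"]) auto
next
  fix y' w assume w: "y = y' @ w" "length w \<le> N" "lattice_path \<Phi> x y' (a # s) (w @ t)"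
  from lattice_path_leaves_column[OF w(3)] show ?thesis
  proof (elim disjE exE conjE)
    assume "lattice_path \<Phi> x (y' @ w) (a # s) t"
    then show ?thesis using w assms(2) by (intro near_pathI1[of _ x _ "[a]"]) auto
  next
    fix w1 w2 assume "w = w1 @ w2" "lattice_path \<Phi> (x @ [a]) (y' @ w1) s (w2 @ t)"
    then show ?thesis using w by (intro near_pathI2[of _ _ "y' @ w1" _ w2]) auto
  qed
qed

text \<open>Here a position ahead on the second tape may move further away until the distance is
  \<open>N\<close>. At distance \<open>N\<close> the hypothesis forces \<open>s = []\<close>, and
  the path must climb through the position.\<close>

lemma near_path_read2:
  assumes "near_path \<Phi> N x y s (b # t)" "0 < N"
    and "\<And>y' w. y = y' @ w \<Longrightarrow> length w = N \<Longrightarrow> lattice_path \<Phi> x y' s (w @ b # t) \<Longrightarrow> s = []"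
  shows "near_path \<Phi> N x (y @ [b]) s t"
  using assms(1)
proof (rule near_pathE)
  fix x' w assume w: "x = x' @ w" "length w \<le> N" "lattice_path \<Phi> x' y (w @ s) (b # t)"
  from lattice_path_leaves_row[OF w(3)] show ?thesis
  proof (elim disjE exE conjE)
    assume "lattice_path \<Phi> (x' @ w) y s (b # t)"
    then show ?thesis using w assms(2) by (intro near_pathI2[of _ _ y _ "[b]"]) auto
  next
    fix w1 w2 assume "w = w1 @ w2" "lattice_path \<Phi> (x' @ w1) (y @ [b]) (w2 @ s) t"
    then show ?thesis using w by (intro near_pathI1[of _ "x' @ w1" _ w2]) auto
  qed
next
  fix y' w assume w: "y = y' @ w" "length w \<le> N" "lattice_path \<Phi> x y' s (w @ b # t)"
  show ?thesis
  proof (cases "length w = N")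
    case True
    then have "s = []" using assms(3) w by blast
    then have "lattice_path \<Phi> x y s (b # t)" using w lattice_path_last_column by blast
    then show "near_path \<Phi> N x (y @ [b]) s t"
      using assms(2) by (intro near_pathI2[of _ _ y _ "[b]"]) auto
  next
    case False
    then show "near_path \<Phi> N x (y @ [b]) s t"
      using w by (intro near_pathI2[of _ _ y' _ "w @ [b]"]) auto
  qed
qed

section \<open>Words over a group\<close>

context group
begin

text \<open>Unlike \<open>word_value\<close> this assigns \<open>\<one>\<close> to the empty word,
  so that products can be split at any place.\<close>

definition word_prod :: "'a list \<Rightarrow> 'a"
  where "word_prod w = foldr (\<otimes>) w \<one>"

lemma word_prod_simps [simp]: "word_prod [] = \<one>" "word_prod (a # w) = a \<otimes> word_prod w"
  by (simp_all add: word_prod_def)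

lemma word_prod_closed [simp]: "set w \<subseteq> carrier G \<Longrightarrow> word_prod w \<in> carrier G"
  by (induction w) auto

lemma word_prod_append:
  "set v \<subseteq> carrier G \<Longrightarrow> set w \<subseteq> carrier G \<Longrightarrow> word_prod (v @ w) = word_prod v \<otimes> word_prod w"
  by (induction v) (auto simp: m_assoc)

lemma word_value_eq_word_prod:
  "w \<noteq> [] \<Longrightarrow> set w \<subseteq> carrier G \<Longrightarrow> word_value G w = word_prod w"
proof (induction w)
  case (Cons a w)
  then show ?case by (cases w) auto
qed simp

text \<open>At a split \<open>(x, y)\<close> in state \<open>(P, S)\<close>, any fixed pair
  \<open>(s', t')\<close> of \<open>S\<close> completes \<open>(x, y)\<close> to a pair of
  \<open>R\<close>. Solving the resulting equation expresses \<open>inv x \<otimes> y\<close> by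
  \<open>s'\<close>, \<open>g\<close> and \<open>t'\<close>, hence by the state alone.\<close>

lemma finite_fellow_travellers:
  assumes A: "A \<subseteq> carrier G" and R: "rational_relation A R" "R \<subseteq> lists A \<times> lists A"
    and g: "g \<in> carrier G" and eq: "\<forall>(u, v)\<in>R. word_prod u \<otimes> g = word_prod v"
  shows "\<exists>F. finite F \<and> F \<subseteq> carrier G \<and> (\<forall>u v. (u, v) \<in> R \<longrightarrow>
    lattice_path (\<lambda>x y s t. inv (word_prod x) \<otimes> word_prod y \<in> F) [] [] u v)"
proof -
  obtain K where K: "finite K"
    "\<And>P S x y s t. (P, S) \<in> K \<Longrightarrow> (x, y) \<in> P \<Longrightarrow> (s, t) \<in> S \<Longrightarrow> (x @ s, y @ t) \<in> R"
    "\<And>u v. (u, v) \<in> R \<Longrightarrow> lattice_path (\<lambda>x y s t. split_in K (x, y) (s, t)) [] [] u v"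
    using rational_relation_lattice_paths[OF R(1)] by metis
  define d where "d = (\<lambda>(s, t). word_prod s \<otimes> g \<otimes> inv (word_prod t))"
  define c where "c = (\<lambda>S. d (SOME m. m \<in> S))"
  have quotient: "inv (word_prod x) \<otimes> word_prod y = c S \<and> c S \<in> carrier G"
    if PS: "(P, S) \<in> K" "(x, y) \<in> P" "(s, t) \<in> S" for P S x y s t
  proof -
    obtain s' t' where st: "(SOME m. m \<in> S) = (s', t')" by (cases "SOME m. m \<in> S")
    have "(s', t') \<in> S" using PS(3) st by (metis someI)
    then have mem: "(x @ s', y @ t') \<in> R" using K(2) PS by blast
    then have sets: "set x \<subseteq> carrier G" "set y \<subseteq> carrier G" "set s' \<subseteq> carrier G" "set t' \<subseteq> carrier G"
      and prod: "word_prod (x @ s') \<otimes> g = word_prod (y @ t')"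
      using subsetD[OF R(2) mem] A bspec[OF eq mem] by auto
    let ?x = "word_prod x" and ?y = "word_prod y" and ?s = "word_prod s'" and ?t = "word_prod t'"
    have C: "?x \<in> carrier G" "?y \<in> carrier G" "?s \<in> carrier G" "?t \<in> carrier G"
      using sets by auto
    have "?x \<otimes> (?s \<otimes> g) = ?y \<otimes> ?t"
      using prod sets C g by (simp add: word_prod_append m_assoc)
    then have "?s \<otimes> g = inv ?x \<otimes> ?y \<otimes> ?t"
      using C g by (metis inv_closed inv_solve_left m_assoc m_closed)
    then have "?s \<otimes> g \<otimes> inv ?t = inv ?x \<otimes> ?y"
      using C g by (metis inv_closed inv_solve_right m_closed)
    then show ?thesis using C g st by (simp add: c_def d_def)
  qed
  \<comment> \<open>For an empty \<open>S\<close> the chosen pair is arbitrary, so membership in the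
    carrier is enforced here.\<close>
  let ?F = "c ` snd ` K \<inter> carrier G"
  show ?thesis
  proof (intro exI[of _ ?F] conjI allI impI)
    show "finite ?F" "?F \<subseteq> carrier G" using K(1) by auto
    fix u v assume "(u, v) \<in> R"
    from K(3)[OF this]
    show "lattice_path (\<lambda>x y s t. inv (word_prod x) \<otimes> word_prod y \<in> ?F) [] [] u v"
    proof (rule lattice_path_mono)
      fix x y s t assume "split_in K (x, y) (s, t)"
      then obtain P S where PS: "(P, S) \<in> K" "(x, y) \<in> P" "(s, t) \<in> S" by (rule split_inE)
      then have "c S \<in> c ` snd ` K" by force
      then show "inv (word_prod x) \<otimes> word_prod y \<in> ?F" using quotient[OF PS] by simp
    qed
  qed
qed

text \<open>Infinitely many factors with the same value and the same left quotients could be completed by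
  the same prefix and suffix to words of \<open>L\<close>, all of them with the same value.\<close>

lemma finite_to_one_imp_departure:
  assumes A: "A \<subseteq> carrier G" and L: "rational_language A L"
    and fin: "\<And>g. finite {w \<in> L. word_prod w = g}" and E: "finite E"
  shows "\<exists>N. \<forall>x y z. x @ y @ z \<in> L \<longrightarrow> word_prod y \<in> E \<longrightarrow> length y < N"
proof -
  let ?D = "range (left_quotient L)"
  define rep where "rep = (\<lambda>D. SOME x. left_quotient L x = D)"
  define tail where "tail = (\<lambda>D :: 'a list set. SOME z. z \<in> D)"
  define T where "T = (\<lambda>(C, D, e). {y. rep C @ y @ tail D \<in> L \<and>
    word_prod (rep C @ y @ tail D) = word_prod (rep C) \<otimes> e \<otimes> word_prod (tail D)})"
  have "finite (T k)" for k
  proof -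
    obtain C D e where k: "k = (C, D, e)" by (cases k)
    have "inj (\<lambda>y. rep C @ y @ tail D)" by (auto simp: inj_on_def)
    then have "finite ((\<lambda>y. rep C @ y @ tail D) -`
        {w \<in> L. word_prod w = word_prod (rep C) \<otimes> e \<otimes> word_prod (tail D)})"
      using fin by (intro finite_vimageI)
    then show ?thesis by (simp add: k T_def vimage_def)
  qed
  then have finT: "finite (\<Union>k\<in>?D \<times> ?D \<times> E. T k)"
    using rational_finite_left_quotients[OF L] E by blast
  have mem: "y \<in> (\<Union>k\<in>?D \<times> ?D \<times> E. T k)" if xyz: "x @ y @ z \<in> L" "word_prod y \<in> E" for x y z
  proof -
    define C where "C = left_quotient L x"
    \<comment> \<open>The prefixes \<open>x\<close> and \<open>rep C\<close> have the same left
      quotient, so \<open>D\<close> is also the quotient by \<open>x @ y\<close>.\<close>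
    define D where "D = left_quotient L (rep C @ y)"
    have rep: "left_quotient L (rep C) = C" unfolding rep_def C_def by (rule someI) simp
    have "y @ z \<in> C" using xyz by (simp add: C_def left_quotient_def)
    then have "z \<in> D" by (simp add: D_def left_quotient_append rep) (simp add: left_quotient_def)
    then have "tail D \<in> D" unfolding tail_def by (rule someI)
    then have w: "rep C @ y @ tail D \<in> L" by (simp add: D_def left_quotient_def)
    then have "set (rep C) \<subseteq> carrier G" "set y \<subseteq> carrier G" "set (tail D) \<subseteq> carrier G"
      using subsetD[OF rational_language_lists[OF L] w] A by auto
    then have "word_prod (rep C @ y @ tail D) = word_prod (rep C) \<otimes> word_prod y \<otimes> word_prod (tail D)"
      by (simp add: word_prod_append m_assoc)
    then have "y \<in> T (C, D, word_prod y)" using w by (simp add: T_def)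
    then show ?thesis using xyz(2) by (auto simp: C_def D_def)
  qed
  \<comment> \<open>The bound is evaluated only when some \<open>y\<close> lies in the union, so
    \<open>Max\<close> is never applied to the empty set where it matters.\<close>
  show ?thesis
  proof (intro exI[of _ "Suc (Max (length ` (\<Union>k\<in>?D \<times> ?D \<times> E. T k)))"] allI impI)
    fix x y z assume "x @ y @ z \<in> L" "word_prod y \<in> E"
    then have "length y \<in> length ` (\<Union>k\<in>?D \<times> ?D \<times> E. T k)" by (intro imageI mem)
    then show "length y < Suc (Max (length ` (\<Union>k\<in>?D \<times> ?D \<times> E. T k)))"
      using finT by (simp add: less_Suc_eq_le)
  qed
qed

text \<open>Deleting factors of value \<open>\<one>\<close> shortens a word, so it ends at a word
  outside \<open>Bad\<close> with the same value. For a fixed \<open>u\<close>, the pumping lemma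
  puts every equivalent word that is long compared with \<open>u\<close> into
  \<open>Bad\<close>.\<close>

lemma quasi_automatic_finite_to_one:
  assumes finA: "finite A" and A: "A \<subseteq> carrier G" and L: "rational_language A L" "[] \<notin> L"
    and R: "rational_relation A {(u, v). u \<in> L \<and> v \<in> L \<and> word_prod u = word_prod v}"
  shows "\<exists>L'. rational_language A L' \<and> L' \<subseteq> L \<and> word_prod ` L' = word_prod ` L \<and>
    (\<forall>g. finite {w \<in> L'. word_prod w = g})"
proof -
  let ?R = "{(u, v). u \<in> L \<and> v \<in> L \<and> word_prod u = word_prod v}"
  obtain n where n: "\<forall>u v. (u, v) \<in> ?R \<longrightarrow> n * (length u + 1) \<le> length v \<longrightarrow>
    (\<exists>v1 y v2. v = v1 @ y @ v2 \<and> y \<noteq> [] \<and> length y \<le> n \<and> (u, v1 @ v2) \<in> ?R)"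
    using rational_relation_pumping[OF R] ..
  \<comment> \<open>The length bound makes \<open>Y\<close> finite, so that inserting its elements
    into words of \<open>L\<close> gives a rational language.\<close>
  define Y where "Y = {y. set y \<subseteq> A \<and> length y \<le> n \<and> y \<noteq> [] \<and> word_prod y = \<one>}"
  define Bad where "Bad = {x @ y @ z |x y z. y \<in> Y \<and> x @ z \<in> L}"
  have LA: "set w \<subseteq> A" if "w \<in> L" for w
    using rational_language_lists[OF L(1)] that by auto
  have "Y \<subseteq> {y. set y \<subseteq> A \<and> length y \<le> n}" by (auto simp: Y_def)
  then have "finite Y" using finite_lists_length_le[OF finA] by (rule finite_subset)
  then have "rational_language A Bad"
    unfolding Bad_def using finA L by (intro rational_language_insertion) (auto simp: Y_def)
  then have rat: "rational_language A (L - Bad)" by (intro rational_language_Diff finA L)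
  have "word_prod w \<in> word_prod ` (L - Bad)" if "w \<in> L" for w
    using that
  proof (induction w rule: length_induct)
    case (1 w)
    show ?case
    proof (cases "w \<in> Bad")
      case False
      then show ?thesis using 1 by auto
    next
      case True
      then obtain x y z where w: "w = x @ y @ z" "y \<in> Y" "x @ z \<in> L" by (auto simp: Bad_def)
      have "set x \<subseteq> carrier G" "set y \<subseteq> carrier G" "set z \<subseteq> carrier G"
        using LA[OF w(3)] w(2) A by (auto simp: Y_def)
      then have "word_prod w = word_prod (x @ z)"
        using w by (simp add: word_prod_append Y_def)
      moreover have "length (x @ z) < length w" using w by (auto simp: Y_def)
      ultimately show ?thesis using 1 w(3) by metis
    qed
  qed
  then have onto: "word_prod ` (L - Bad) = word_prod ` L" by auto
  have finite: "finite {w \<in> L - Bad. word_prod w = g}" for g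
  proof (cases "\<exists>u\<in>L. word_prod u = g")
    case False
    then have "{w \<in> L - Bad. word_prod w = g} = {}" by auto
    then show ?thesis by (simp only: finite.emptyI)
  next
    case True
    then obtain u where u: "u \<in> L" "word_prod u = g" by auto
    have "length v \<le> n * (length u + 1)" if v: "v \<in> L - Bad" "word_prod v = g" for v
    proof (rule ccontr)
      assume "\<not> length v \<le> n * (length u + 1)"
      then obtain v1 y v2 where y: "v = v1 @ y @ v2" "y \<noteq> []" "length y \<le> n" "(u, v1 @ v2) \<in> ?R"
        using n[rule_format, of u v] u v by auto
      have sets: "set v1 \<subseteq> carrier G" "set y \<subseteq> carrier G" "set v2 \<subseteq> carrier G" "set y \<subseteq> A"
        using LA[of v] v y(1) A by auto
      \<comment> \<open>Both \<open>v\<close> and the shortened word have the value of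
        \<open>u\<close>; cancellation shows that the factor removed by pumping has value
        \<open>\<one>\<close>.\<close>
      have "word_prod v1 \<otimes> (word_prod y \<otimes> word_prod v2) = word_prod v1 \<otimes> word_prod v2"
        using y v u sets by (simp add: word_prod_append)
      then have "word_prod y \<otimes> word_prod v2 = word_prod v2"
        using sets by simp
      then have "word_prod y = \<one>" using sets by simp
      then have "v \<in> Bad" using y sets by (auto simp: Bad_def Y_def)
      then show False using v by auto
    qed
    then have "{w \<in> L - Bad. word_prod w = g} \<subseteq> {w. set w \<subseteq> A \<and> length w \<le> n * (length u + 1)}"
      using LA by auto
    then show ?thesis using finite_lists_length_le[OF finA] by (rule finite_subset)
  qed
  show ?thesis using rat onto finite by blast
qed

end

section \<open>The automaton of a departing language\<close>

definition lastn :: "nat \<Rightarrow> 'a list \<Rightarrow> 'a list"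
  where "lastn n w = drop (length w - n) w"

lemma length_lastn: "length (lastn n w) \<le> n"
  by (simp add: lastn_def)

text \<open>The window can be updated from itself, without the letters that have left it.\<close>

lemma lastn_lastn_append: "lastn n (lastn n v @ w) = lastn n (v @ w)"
  by (cases "length v \<le> n") (auto simp: lastn_def add.commute)

lemma lastn_suffix: "length w = n \<Longrightarrow> lastn n (v @ w) = w"
  by (simp add: lastn_def)

lemma lastn_prefix:
  obtains v where "w = v @ lastn n w"
  by (metis append_take_drop_id lastn_def)

lemma set_lastn: "set (lastn n w) \<subseteq> set w"
  by (simp add: lastn_def set_drop_subset)

text \<open>In \<open>departure\<close>, \<open>inv f \<otimes> f'\<close> is the value of a factor
  of the second word between two points of one column whose differences are \<open>f\<close> and
  \<open>f'\<close>. The element \<open>\<one>\<close> in \<open>F\<close> is the difference at the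
  start, so that the initial state is legitimate even when no pair is accepted.\<close>

locale departing_language = group G for G (structure) +
  fixes A L F N g
  assumes finA: "finite A" and A: "A \<subseteq> carrier G"
    and L: "rational_language A L"
    and F: "finite F" "F \<subseteq> carrier G" "\<one> \<in> F"
    and N: "0 < N"
    and departure: "\<And>x y z f f'. x @ y @ z \<in> L \<Longrightarrow> f \<in> F \<Longrightarrow> f' \<in> F \<Longrightarrow>
      word_prod y = inv f \<otimes> f' \<Longrightarrow> length y < N"
    and g: "g \<in> carrier G"
    and path: "\<And>u v. u \<in> L \<Longrightarrow> v \<in> L \<Longrightarrow> word_prod u \<otimes> g = word_prod v \<Longrightarrow>
      lattice_path (\<lambda>x y s t. inv (word_prod x) \<otimes> word_prod y \<in> F) [] [] u v"
begin

abbreviation "\<Phi> \<equiv> \<lambda>x y (s :: 'a list) (t :: 'a list). inv (word_prod x) \<otimes> word_prod y \<in> F"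

definition windows where "windows = {w. set w \<subseteq> A \<and> length w \<le> N}"

text \<open>These are the possible differences near a path: \<open>f\<close> belongs to a point of
  the path, while \<open>v\<close> and \<open>w\<close> are the surplus letters on the first and
  second tape.\<close>

definition differences where
  "differences = (\<lambda>(v, f, w). inv (word_prod v) \<otimes> f \<otimes> word_prod w) ` (windows \<times> F \<times> windows)"

text \<open>A state consists of the left quotients of \<open>L\<close> by the words \<open>x\<close> and \<open>y\<close> read so far, two flags
  for the end markers, the group element \<open>inv x \<otimes> y\<close> and the last \<open>N\<close> letters of \<open>y\<close>.\<close>

definition states :: "('a list set \<times> 'a list set \<times> bool \<times> bool \<times> 'a \<times> 'a list) set" where
  "states = range (left_quotient L) \<times> range (left_quotient L) \<times> UNIV \<times> UNIV \<times> differences \<times> windows"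

text \<open>The condition \<open>h \<otimes> inv (word_prod w) \<in> F\<close> says that \<open>x\<close> matches the prefix that \<open>y\<close> had \<open>N\<close>
  letters earlier, so that the second tape must wait.\<close>

fun reads1 where
  "reads1 (D1, D2, f1, f2, h, w) \<longleftrightarrow>
    \<not> f1 \<and> (f2 \<or> length w = N \<and> h \<otimes> inv (word_prod w) \<in> F)"

fun next1 where
  "next1 (D1, D2, f1, f2, h, w) (Some a) = (left_quotient D1 [a], D2, f1, f2, inv a \<otimes> h, w)"
| "next1 (D1, D2, f1, f2, h, w) None = (D1, D2, True, f2, h, w)"

fun next2 where
  "next2 (D1, D2, f1, f2, h, w) (Some b) =
    (D1, left_quotient D2 [b], f1, f2, h \<otimes> b, lastn N (w @ [b]))"
| "next2 (D1, D2, f1, f2, h, w) None = (D1, D2, f1, True, h, w)"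

definition "next_state q x = (if reads1 q then next1 q x else next2 q x)"

text \<open>Transitions leaving \<open>states\<close> are undefined, which keeps the automaton
  finite; runs that stay near a path never need them. The final states test membership of both words
  in \<open>L\<close> and the difference \<open>g\<close>.\<close>

definition automaton where
  "automaton = \<lparr>states1 = {q \<in> states. reads1 q}, states2 = {q \<in> states. \<not> reads1 q},
    initial = (L, L, False, False, \<one>, []),
    final = {(D1, D2, f1, f2, h, w) \<in> states. f1 \<and> f2 \<and> [] \<in> D1 \<and> [] \<in> D2 \<and> h = g},
    trans = (\<lambda>q x. if q \<in> states \<and> x \<in> insert None (Some ` A) \<and> next_state q x \<in> states
      then Some (next_state q x) else None)\<rparr>"

definition state_after where
  "state_after x y f1 f2 = (left_quotient L x, left_quotient L y, f1, f2,
    inv (word_prod x) \<otimes> word_prod y, lastn N y)"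

lemma LA: "w \<in> L \<Longrightarrow> set w \<subseteq> A"
  using rational_language_lists[OF L] by auto

lemma finite_windows: "finite windows"
  unfolding windows_def by (rule finite_lists_length_le[OF finA])

lemma finite_states: "finite states"
  using finite_windows F(1) rational_finite_left_quotients[OF L]
  by (simp add: states_def differences_def)

lemma state_after_in_states:
  assumes "near_path \<Phi> N x y s t" "set x \<subseteq> A" "set y \<subseteq> A"
  shows "state_after x y f1 f2 \<in> states"
proof -
  have xy: "set x \<subseteq> carrier G" "set y \<subseteq> carrier G" using assms A by auto
  have "inv (word_prod x) \<otimes> word_prod y \<in> differences"
    using assms(1)
  proof (rule near_pathE)
    fix x' w assume w: "x = x' @ w" "length w \<le> N" "lattice_path \<Phi> x' y (w @ s) t"
    let ?f = "inv (word_prod x') \<otimes> word_prod y"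
    have "(w, ?f, []) \<in> windows \<times> F \<times> windows"
      using lattice_path_start[OF w(3)] w assms by (auto simp: windows_def)
    moreover have "inv (word_prod x) \<otimes> word_prod y =
        inv (word_prod w) \<otimes> ?f \<otimes> word_prod []"
      using xy w(1) by (simp add: word_prod_append inv_mult_group m_assoc)
    ultimately show ?thesis unfolding differences_def by force
  next
    fix y' w assume w: "y = y' @ w" "length w \<le> N" "lattice_path \<Phi> x y' s (w @ t)"
    let ?f = "inv (word_prod x) \<otimes> word_prod y'"
    have "([], ?f, w) \<in> windows \<times> F \<times> windows"
      using lattice_path_start[OF w(3)] w assms by (auto simp: windows_def)
    moreover have "inv (word_prod x) \<otimes> word_prod y =
        inv (word_prod []) \<otimes> ?f \<otimes> word_prod w"
      using xy w(1) by (simp add: word_prod_append m_assoc)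
    ultimately show ?thesis unfolding differences_def by force
  qed
  moreover have "lastn N y \<in> windows"
    using set_lastn[of N y] length_lastn[of N y] assms(3) by (auto simp: windows_def)
  ultimately show ?thesis by (simp add: state_after_def states_def)
qed

lemma next1_state_after:
  assumes "set x \<subseteq> A" "set y \<subseteq> A" "a \<in> A"
  shows "next1 (state_after x y f1 f2) (Some a) = state_after (x @ [a]) y f1 f2"
proof -
  have "set x \<subseteq> carrier G" "set y \<subseteq> carrier G" "a \<in> carrier G" using assms A by auto
  then show ?thesis
    by (simp add: state_after_def left_quotient_append word_prod_append inv_mult_group m_assoc)
qed

lemma next2_state_after:
  assumes "set x \<subseteq> A" "set y \<subseteq> A" "b \<in> A"
  shows "next2 (state_after x y f1 f2) (Some b) = state_after x (y @ [b]) f1 f2"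
proof -
  have "set x \<subseteq> carrier G" "set y \<subseteq> carrier G" "b \<in> carrier G" using assms A by auto
  then show ?thesis
    by (simp add: state_after_def left_quotient_append word_prod_append m_assoc lastn_lastn_append)
qed

text \<open>The quotients and the difference \<open>h\<close> are tracked exactly, so acceptance is
  correct whatever order of reading is chosen. The window \<open>w\<close> only steers that
  order.\<close>

lemma accepts_sound:
  assumes "accepts_from automaton q xs ys"
    and "q = (D1, D2, f1, f2, h, w)" "xs = unread f1 s" "ys = unread f2 t"
    and "f1 \<Longrightarrow> s = []" "f2 \<Longrightarrow> t = []" "set s \<subseteq> A" "set t \<subseteq> A" "h \<in> carrier G"
  shows "s \<in> D1 \<and> t \<in> D2 \<and> word_prod s \<otimes> g = h \<otimes> word_prod t"
  using assms
proof (induction arbitrary: D1 D2 f1 f2 h w s t)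
  case (finished q)
  then have "f1" "f2" using unread_Nil_iff by metis+
  then show ?case using finished g by (auto simp: automaton_def)
next
  case (read1 q x q' xs ys)
  then have q: "reads1 q" "q' = next1 q x"
    by (auto simp: automaton_def next_state_def split: if_splits)
  from read1.prems(2) show ?case
  proof (cases rule: unread_Cons_cases)
    case 1
    then show ?thesis
      using read1.IH[of D1 D2 True f2 h w s t] read1.prems q by auto
  next
    case (2 a s')
    have C: "a \<in> carrier G" "set s' \<subseteq> carrier G" "set t \<subseteq> carrier G"
      using read1.prems 2 A by auto
    have "s' \<in> left_quotient D1 [a] \<and> t \<in> D2 \<and> word_prod s' \<otimes> g = inv a \<otimes> h \<otimes> word_prod t"
      using read1.prems q 2 C by (intro read1.IH[of _ _ f1 f2 _ w]) auto
    moreover have "a \<otimes> (inv a \<otimes> h \<otimes> word_prod t) = h \<otimes> word_prod t"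
      using C read1.prems(8) by (simp add: m_assoc[symmetric])
    ultimately show ?thesis
      using 2 C g by (simp add: left_quotient_def m_assoc)
  qed
next
  case (read2 q y q' xs ys)
  then have q: "\<not> reads1 q" "q' = next2 q y"
    by (auto simp: automaton_def next_state_def split: if_splits)
  from read2.prems(3) show ?case
  proof (cases rule: unread_Cons_cases)
    case 1
    then show ?thesis
      using read2.IH[of D1 D2 f1 True h w s t] read2.prems q by auto
  next
    case (2 b t')
    have C: "b \<in> carrier G" "set s \<subseteq> carrier G" "set t' \<subseteq> carrier G"
      using read2.prems 2 A by auto
    have "s \<in> D1 \<and> t' \<in> left_quotient D2 [b] \<and> word_prod s \<otimes> g = h \<otimes> b \<otimes> word_prod t'"
      using read2.prems q 2 C by (intro read2.IH[of _ _ f1 f2 _ "lastn N (w @ [b])"]) auto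
    then show ?thesis
      using 2 C read2.prems(8) by (simp add: left_quotient_def m_assoc)
  qed
qed

text \<open>When the second tape waits, the path cannot be behind on the first tape: otherwise it would
  pass the current column beyond \<open>y\<close>, against the departure property.\<close>

lemma near_path_first_step:
  assumes near: "near_path \<Phi> N x y (a # s) t" and r: "reads1 (state_after x y False f2)"
    and "f2 \<Longrightarrow> t = []" and xL: "x @ a # s \<in> L" and yL: "y @ t \<in> L"
  shows "near_path \<Phi> N (x @ [a]) y s t"
proof (rule near_path_read1[OF near N])
  fix x' w assume w: "x = x' @ w" "lattice_path \<Phi> x' y (w @ a # s) t"
  show "t = []"
  proof (cases f2)
    case False
    obtain y0 where y0: "y = y0 @ lastn N y" using lastn_prefix[of y N] .
    let ?w = "lastn N y"
    have C: "set x \<subseteq> carrier G" "set y0 \<subseteq> carrier G" "set ?w \<subseteq> carrier G" "set t \<subseteq> carrier G"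
    proof -
      have "set (y0 @ ?w) \<subseteq> carrier G" using LA[OF yL] A y0 by auto
      then show "set y0 \<subseteq> carrier G" "set ?w \<subseteq> carrier G" by auto
      show "set x \<subseteq> carrier G" "set t \<subseteq> carrier G" using LA[OF xL] LA[OF yL] A by auto
    qed
    have len: "length ?w = N" and f: "inv (word_prod x) \<otimes> word_prod y \<otimes> inv (word_prod ?w) \<in> F"
      using r False by (auto simp: state_after_def)
    \<comment> \<open>Cancelling the window turns the waiting condition into a statement about the
      prefix \<open>y0\<close>, which is \<open>N\<close> letters shorter than
      \<open>y\<close>.\<close>
    have f: "inv (word_prod x) \<otimes> word_prod y0 \<in> F" 
    proof -
      have "word_prod y = word_prod y0 \<otimes> word_prod ?w"
        using C by (subst y0) (simp add: word_prod_append)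
      then show ?thesis using f C by (simp add: m_assoc)
    qed
    \<comment> \<open>From row \<open>y\<close> the path still has to reach the column of
      \<open>x\<close>. There the factor from \<open>y0\<close> to \<open>y @ z\<close> joins two
      differences in \<open>F\<close>, although it contains the whole window of length
      \<open>N\<close>.\<close>
    obtain z t' where t: "t = z @ t'" and "lattice_path \<Phi> (x' @ w) (y @ z) (a # s) t'"
      using lattice_path_to_column[OF w(2)] by blast
    then have f': "inv (word_prod x) \<otimes> word_prod (y @ z) \<in> F"
      using lattice_path_start w(1) by fastforce
    have z: "set z \<subseteq> carrier G" using C t by auto
    have "word_prod (y @ z) = word_prod (y0 @ ?w @ z)" using y0 by (metis append.assoc)
    then have "word_prod (?w @ z) =
        inv (inv (word_prod x) \<otimes> word_prod y0) \<otimes> (inv (word_prod x) \<otimes> word_prod (y @ z))"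
      using C z by (simp add: word_prod_append inv_mult_group m_assoc[symmetric])
        (simp add: m_assoc)
    moreover have "y0 @ (?w @ z) @ t' \<in> L" using yL y0 t by (metis append.assoc)
    ultimately have "length (?w @ z) < N" using departure f f' by blast
    then show ?thesis using len by simp
  qed (use assms in auto)
qed

text \<open>At distance exactly \<open>N\<close> the window is the surplus \<open>w\<close>, so the
  difference before it lies in \<open>F\<close>. The automaton then reads the second tape only if
  the first one is exhausted.\<close>

lemma near_path_second_step:
  assumes near: "near_path \<Phi> N x y s (b # t)" and r: "\<not> reads1 (state_after x y f1 False)"
    and "f1 \<Longrightarrow> s = []" and xL: "x @ s \<in> L" and yL: "y @ b # t \<in> L"
  shows "near_path \<Phi> N x (y @ [b]) s t"
proof (rule near_path_read2[OF near N])
  fix y' w assume w: "y = y' @ w" "length w = N" "lattice_path \<Phi> x y' s (w @ b # t)"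
  have C: "set x \<subseteq> carrier G" "set y' \<subseteq> carrier G" "set w \<subseteq> carrier G"
    using LA[OF xL] LA[OF yL] A w(1) by auto
  have "inv (word_prod x) \<otimes> word_prod y \<otimes> inv (word_prod w) = inv (word_prod x) \<otimes> word_prod y'"
    using C w(1) by (simp add: word_prod_append m_assoc)
  then have "f1"
    using r w lattice_path_start[OF w(3)] lastn_suffix[OF w(2), of y'] by (auto simp: state_after_def)
  then show "s = []" using assms by simp
qed

text \<open>Closeness to the path is the invariant of the run, and it keeps every state inside
  \<open>states\<close>. The induction measure also counts the unread end markers, since reading one
  consumes no letter.\<close>

lemma accepts_complete:
  assumes "near_path \<Phi> N x y s t" "x @ s \<in> L" "y @ t \<in> L"
    and "word_prod (x @ s) \<otimes> g = word_prod (y @ t)"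
    and "f1 \<Longrightarrow> s = []" "f2 \<Longrightarrow> t = []"
  shows "accepts_from automaton (state_after x y f1 f2) (unread f1 s) (unread f2 t)"
  using assms
proof (induction "length s + length t + (if f1 then 0 else 1) + (if f2 then 0 else 1)"
    arbitrary: x y s t f1 f2 rule: less_induct)
  case less
  let ?q = "state_after x y f1 f2"
  have sets: "set x \<subseteq> A" "set y \<subseteq> A" "set s \<subseteq> A" "set t \<subseteq> A"
    using LA[OF less.prems(2)] LA[OF less.prems(3)] by auto
  have q: "?q \<in> states" using state_after_in_states less.prems(1) sets by blast
  have C: "word_prod x \<in> carrier G" "word_prod y \<in> carrier G" using sets A by auto
  show ?case
  proof (cases "f1 \<and> f2")
    case True
    then have st: "s = []" "t = []" using less.prems by auto
    have "inv (word_prod x) \<otimes> word_prod y = g"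
      using less.prems(4) st C g by (metis append_Nil2 inv_solve_left)
    then have "?q \<in> final automaton"
      using q True st less.prems(2,3) by (auto simp: automaton_def state_after_def left_quotient_def)
    then show ?thesis using True by (auto intro: accepts_from.finished)
  next
    case False
    show ?thesis
    proof (cases "reads1 ?q")
      case r: True
      then have f1: "\<not> f1" by (simp add: state_after_def)
      show ?thesis
      proof (cases s)
        case Nil
        have q': "next_state ?q None = state_after x y True f2" using r by (simp add: next_state_def state_after_def)
        have "accepts_from automaton (state_after x y True f2) (unread True s) (unread f2 t)"
          using less.prems Nil f1 by (intro less.hyps) auto
        moreover have "state_after x y True f2 \<in> states"
          using state_after_in_states less.prems(1) sets by blast
        ultimately have "accepts_from automaton ?q (None # []) (unread f2 t)"
          using q r q' by (intro accepts_from.read1) (auto simp: automaton_def)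
        then show ?thesis using f1 Nil by simp
      next
        case (Cons a s')
        have q': "next_state ?q (Some a) = state_after (x @ [a]) y f1 f2"
          using r next1_state_after[OF sets(1,2), of a f1 f2] sets(3) Cons by (simp add: next_state_def)
        have near: "near_path \<Phi> N (x @ [a]) y s' t"
          using near_path_first_step[of x y a s' t f2] less.prems Cons r f1 by simp
        have "accepts_from automaton (state_after (x @ [a]) y f1 f2) (unread f1 s') (unread f2 t)"
          using less.prems Cons near f1 by (intro less.hyps) auto
        moreover have "state_after (x @ [a]) y f1 f2 \<in> states"
          using state_after_in_states[OF near] sets Cons by auto
        ultimately have "accepts_from automaton ?q (Some a # unread f1 s') (unread f2 t)"
          using q r q' sets Cons by (intro accepts_from.read1) (auto simp: automaton_def)
        then show ?thesis using f1 Cons by simp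
      qed
    next
      case r: False
      then have f2: "\<not> f2" using False by (auto simp: state_after_def)
      show ?thesis
      proof (cases t)
        case Nil
        have q': "next_state ?q None = state_after x y f1 True" using r by (simp add: next_state_def state_after_def)
        have "accepts_from automaton (state_after x y f1 True) (unread f1 s) (unread True t)"
          using less.prems Nil f2 by (intro less.hyps) auto
        moreover have "state_after x y f1 True \<in> states"
          using state_after_in_states less.prems(1) sets by blast
        ultimately have "accepts_from automaton ?q (unread f1 s) (None # [])"
          using q r q' by (intro accepts_from.read2) (auto simp: automaton_def)
        then show ?thesis using f2 Nil by simp
      next
        case (Cons b t')
        have q': "next_state ?q (Some b) = state_after x (y @ [b]) f1 f2"
          using r next2_state_after[OF sets(1,2), of b f1 f2] sets(4) Cons by (simp add: next_state_def)
        have near: "near_path \<Phi> N x (y @ [b]) s t'"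
          using near_path_second_step[of x y s b t' f1] less.prems Cons r f2 by simp
        have "accepts_from automaton (state_after x (y @ [b]) f1 f2) (unread f1 s) (unread f2 t')"
          using less.prems Cons near f2 by (intro less.hyps) auto
        moreover have "state_after x (y @ [b]) f1 f2 \<in> states"
          using state_after_in_states[OF near] sets Cons by auto
        ultimately have "accepts_from automaton ?q (unread f1 s) (Some b # unread f2 t')"
          using q r q' sets Cons by (intro accepts_from.read2) (auto simp: automaton_def)
        then show ?thesis using f2 Cons by simp
      qed
    qed
  qed
qed

lemma initial_automaton: "initial automaton = state_after [] [] False False"
  by (simp add: automaton_def state_after_def lastn_def)

lemma automaton_over: "two_tape_automaton_over A automaton"
proof -
  \<comment> \<open>The one-point path of the empty pair places the initial state in
    \<open>states\<close>.\<close>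
  have "near_path \<Phi> N [] [] [] []"
    using F(3) by (auto intro!: near_pathI1[of _ "[]" _ "[]"] lattice_path.stop)
  then have "initial automaton \<in> states"
    unfolding initial_automaton by (rule state_after_in_states) auto
  then show ?thesis
    using finite_states unfolding two_tape_automaton_over_def
    by (auto simp: automaton_def split: if_splits)
qed

lemma accepted_relation_automaton:
  "accepted_relation A automaton = {(u, v). u \<in> L \<and> v \<in> L \<and> word_prod u \<otimes> g = word_prod v}"
proof (intro equalityI subsetI; clarify)
  fix u v assume "(u, v) \<in> accepted_relation A automaton"
  then have *: "set u \<subseteq> A" "set v \<subseteq> A"
    "accepts_from automaton (initial automaton) (unread False u) (unread False v)"
    by (auto simp: accepted_relation_def unread_def)
  moreover have "word_prod v \<in> carrier G" using * A by auto
  ultimately show "u \<in> L \<and> v \<in> L \<and> word_prod u \<otimes> g = word_prod v"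
    using accepts_sound[OF *(3), of L L False False \<one> "[]" u v] by (simp add: automaton_def)
next
  fix u v assume *: "u \<in> L" "v \<in> L" "word_prod u \<otimes> g = word_prod v"
  have "near_path \<Phi> N [] [] u v"
    using path[OF *] by (auto intro!: near_pathI1[of _ "[]" _ "[]"])
  then have "accepts_from automaton (initial automaton) (unread False u) (unread False v)"
    unfolding initial_automaton using * by (intro accepts_complete) auto
  then show "(u, v) \<in> accepted_relation A automaton"
    using LA * by (auto simp: accepted_relation_def unread_def)
qed

lemma two_tape_recognizable_mult:
  "two_tape_recognizable A {(u, v). u \<in> L \<and> v \<in> L \<and> word_prod u \<otimes> g = word_prod v}"
  using two_tape_recognizableI[OF automaton_over] by (simp add: accepted_relation_automaton)

end

section \<open>Quasi-automatic groups are asynchronously automatic\<close>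

lemma (in group) quasi_automatic_imp_asynchronously_automatic:
  assumes "quasi_automatic G"
  shows "asynchronously_automatic G"
proof -
  obtain A L where finA: "finite A" and gen: "semigroup_generators G A"
    and dict: "quasi_automatic_dictionary G A L"
    using assms unfolding quasi_automatic_def by blast
  have A: "A \<subseteq> carrier G" using gen by (simp add: semigroup_generators_def)
  have L: "rational_language A L" "L \<subseteq> nonempty_words A" "word_value G ` L = carrier G"
    and R: "\<And>a. a \<in> letters_or_empty A \<Longrightarrow> rational_relation A (mult_relation G L a)"
    using dict by (auto simp: quasi_automatic_dictionary_def dictionary_def)
  have word: "w \<noteq> []" "set w \<subseteq> carrier G" "word_value G w = word_prod w" if "w \<in> L" for w
    using that L(2) A word_value_eq_word_prod[of w] by (auto simp: nonempty_words_def subset_iff)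
  have letter: "set a \<subseteq> carrier G" if "a \<in> letters_or_empty A" for a
    using that A by (auto simp: letters_or_empty_def)
  have mult: "mult_relation G L' a = {(u, v). u \<in> L' \<and> v \<in> L' \<and> word_prod u \<otimes> word_prod a = word_prod v}"
    if "L' \<subseteq> L" "a \<in> letters_or_empty A" for L' a
  proof -
    have "word_value G (u @ a) = word_prod u \<otimes> word_prod a" if "u \<in> L'" for u
      using word[of u] that \<open>L' \<subseteq> L\<close> letter[OF \<open>a \<in> _\<close>]
      by (subst word_value_eq_word_prod) (auto simp: word_prod_append)
    then show ?thesis
      using word(3) that(1) unfolding mult_relation_def by auto
  qed
  have empty: "[] \<in> letters_or_empty A" by (simp add: letters_or_empty_def)
  have "mult_relation G L [] = {(u, v). u \<in> L \<and> v \<in> L \<and> word_prod u = word_prod v}"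
    using mult[OF subset_refl empty] word(2) by auto
  then have R0: "rational_relation A {(u, v). u \<in> L \<and> v \<in> L \<and> word_prod u = word_prod v}"
    using R[OF empty] by simp
  have nil: "[] \<notin> L" using word(1) by blast
  obtain L' where L': "rational_language A L'" "L' \<subseteq> L" "word_prod ` L' = word_prod ` L"
    "\<forall>g. finite {w \<in> L'. word_prod w = g}"
    using quasi_automatic_finite_to_one[OF finA A L(1) nil R0] by (elim exE conjE) (rule that)
  have "two_tape_recognizable A (mult_relation G L' a)" if a: "a \<in> letters_or_empty A" for a
  proof -
    let ?g = "word_prod a"
    have g: "?g \<in> carrier G" using letter[OF a] by simp
    have LA: "w \<in> lists A" if "w \<in> L" for w using that L(2) by (auto simp: nonempty_words_def)
    have RA: "mult_relation G L a \<subseteq> lists A \<times> lists A"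
      using mult[OF subset_refl a] LA by auto
    have eq: "\<forall>(u, v)\<in>mult_relation G L a. word_prod u \<otimes> ?g = word_prod v"
      using mult[OF subset_refl a] by auto
    \<comment> \<open>The set \<open>F\<close> is obtained from the relation on \<open>L\<close>,
      whose rationality is given; it serves the pairs from \<open>L'\<close> as well.\<close>
    obtain F where F: "finite F" "F \<subseteq> carrier G"
      "\<forall>u v. (u, v) \<in> mult_relation G L a \<longrightarrow>
        lattice_path (\<lambda>x y s t. inv (word_prod x) \<otimes> word_prod y \<in> F) [] [] u v"
      using finite_fellow_travellers[OF A R[OF a] RA g eq] by (elim exE conjE) (rule that)
    let ?F = "insert \<one> F" and ?E = "(\<lambda>(f, f'). inv f \<otimes> f') ` (insert \<one> F \<times> insert \<one> F)"
    have "finite ?E" using F(1) by simp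
    then obtain N where N: "\<forall>x y z. x @ y @ z \<in> L' \<longrightarrow> word_prod y \<in> ?E \<longrightarrow> length y < N"
      using finite_to_one_imp_departure[OF A L'(1) L'(4)[rule_format]] by blast
    \<comment> \<open>The successor guarantees a positive window length.\<close>
    interpret departing_language G A L' ?F "Suc N" ?g
    proof
      fix x y z f f'
      assume "x @ y @ z \<in> L'" "f \<in> ?F" "f' \<in> ?F" "word_prod y = inv f \<otimes> f'"
      then show "length y < Suc N" using N[rule_format, of x y z] by force
    next
      fix u v assume "u \<in> L'" "v \<in> L'" "word_prod u \<otimes> ?g = word_prod v"
      then have "(u, v) \<in> mult_relation G L a" using mult[OF subset_refl a] L'(2) by auto
      then show "lattice_path (\<lambda>x y s t. inv (word_prod x) \<otimes> word_prod y \<in> ?F) [] [] u v"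
        using F(3) by (auto intro: lattice_path_mono)
    qed (use finA A L' F g in auto)
    show ?thesis using two_tape_recognizable_mult mult[OF L'(2) a] by simp
  qed
  moreover have "dictionary G A L'"
  proof -
    have "word_value G ` L' = word_prod ` L'" using word(3) L'(2) by (auto intro!: image_cong)
    also have "\<dots> = word_value G ` L" unfolding L'(3) using word(3) by (auto intro!: image_cong)
    finally show ?thesis using L L' by (auto simp: dictionary_def)
  qed
  ultimately show ?thesis
    using finA gen unfolding asynchronously_automatic_def asynchronously_automatic_dictionary_def by blast
qed

theorem theorem1:
  fixes G :: "('g, 'm) monoid_scheme"
  assumes "group G"
    and "\<exists>X. finite X \<and> X \<subseteq> carrier G \<and> generate G X = carrier G"
  shows "quasi_automatic G \<longleftrightarrow> asynchronously_automatic G"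
  using group.quasi_automatic_imp_asynchronously_automatic[OF assms(1)]
    asynchronously_automatic_imp_quasi_automatic by blast

end
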